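(* Let $\{(N_n,B_n)\}_{n=1}^\infty$ be a sequence of admissible pairs in $\mathbb{R}$ with $N_n>0$ satisfying the remainder bounded condition $\sum_{n=1}^{\infty}\frac{\#B_{n,2}}{\#B_n}<\infty$, where $B_{n,1}=B_n\cap\{0,1,\dots,N_n-1\}$ and $B_{n,2}=B_n\setminus B_{n,1}$. Suppose there exists a subsequence $\{(N_{n_k},B_{n_k})\}_{k=1}^\infty$ satisfying the partial concentration condition. Then the infinite convolution $$\mu=\delta_{N_1^{-1}B_1}*\delta_{(N_2N_1)^{-1}B_2}*\cdots*\delta_{(N_n\cdots N_2N_1)^{-1}B_n}*\cdots$$ exists and is a spectral measure.
   Context: An admissible pair in $\mathbb{R}$ is a pair $(N,B)$ where $N$ is an integer with $|N|>1$ and $B\subseteq\mathbb{Z}$ is finite with $\#B\ge2$, such that there exists $L\subseteq\mathbb{Z}$ with $\#L=\#B$ for which the matrix $\big[\frac{1}{\sqrt{\#B}}e^{-2\pi i (b/N)\ell}\big]_{b\in B,\ell\in L}$ is unitary. Partial concentration condition (PCC): a sequence $\{(M_k,D_k)\}_{k=1}^\infty$ satisfies PCC if for some $l\in(0,1)$ one of the following holds: (i) there are reals $d_{k,1},d_{k,2}\in[0,M_k-1]$ with $0<\frac{d_{k,2}-d_{k,1}}{M_k}<l$ for all $k$ such that $\sum_{k=1}^\infty\frac{\#D^l_{k,2}}{\#D_k}<\infty$, where $D^l_{k,1}=D_k\cap[d_{k,1},d_{k,2}]$ and $D^l_{k,2}=D_k\setminus D^l_{k,1}$; or (ii) there exist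 $c\in(0,1]$ and reals $d_{k,1},d_{k,2}\in[\frac{l}{2}M_k,(1-\frac{l}{2})M_k]$ such that $\frac{\#(D_k\cap[d_{k,1},d_{k,2}])}{\#D_k}\ge c$ for all $k\in\mathbb{N}$. For finite $A\subseteq\mathbb{R}$, $\delta_A=\frac{1}{\#A}\sum_{a\in A}\delta_a$; $*$ is convolution. The infinite convolution is the weak limit (if it exists) of $\mu_n=\delta_{N_1^{-1}B_1}*\cdots*\delta_{(N_n\cdots N_1)^{-1}B_n}$. A Borel probability measure $\mu$ on $\mathbb{R}$ is spectral if there is a countable $\Lambda\subseteq\mathbb{R}$ such that $\{e^{-2\pi i\lambda x}:\lambda\in\Lambda\}$ is an orthonormal basis of $L^2(\mu)$. *)

theory Defs
  imports "HOL-Probability.Probability"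
begin

definition admissible_pair :: "int \<Rightarrow> int set \<Rightarrow> bool" where
  "admissible_pair N B \<longleftrightarrow> \<bar>N\<bar> > 1 \<and> finite B \<and> card B \<ge> 2 \<and>
     (\<exists>L :: int set. finite L \<and> card L = card B \<and>
        (let U = (\<lambda>b l. complex_of_real (1 / sqrt (real (card B))) *
                     cis (- 2 * pi * (real_of_int b / real_of_int N) * real_of_int l))
         in (\<forall>b\<in>B. \<forall>b'\<in>B. (\<Sum>l\<in>L. U b l * cnj (U b' l)) = (if b = b' then 1 else 0)) \<and>
            (\<forall>l\<in>L. \<forall>l'\<in>L. (\<Sum>b\<in>B. cnj (U b l) * U b l') = (if l = l' then 1 else 0))))"

definition pcc :: "(nat \<Rightarrow> int) \<Rightarrow> (nat \<Rightarrow> int set) \<Rightarrow> bool" where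
  "pcc M D \<longleftrightarrow> (\<exists>l::real. 0 < l \<and> l < 1 \<and>
     ((\<exists>d1 d2 :: nat \<Rightarrow> real.
         (\<forall>k. 0 \<le> d1 k \<and> d1 k \<le> real_of_int (M k) - 1 \<and>
              0 \<le> d2 k \<and> d2 k \<le> real_of_int (M k) - 1 \<and>
              0 < (d2 k - d1 k) / real_of_int (M k) \<and> (d2 k - d1 k) / real_of_int (M k) < l) \<and>
         summable (\<lambda>k. real (card (D k - {d \<in> D k. d1 k \<le> real_of_int d \<and> real_of_int d \<le> d2 k}))
                        / real (card (D k))))
      \<or>
      (\<exists>c::real. 0 < c \<and> c \<le> 1 \<and> (\<exists>d1 d2 :: nat \<Rightarrow> real.
         \<forall>k. l / 2 * real_of_int (M k) \<le> d1 k \<and> d1 k \<le> (1 - l / 2) * real_of_int (M k) \<and>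
             l / 2 * real_of_int (M k) \<le> d2 k \<and> d2 k \<le> (1 - l / 2) * real_of_int (M k) \<and>
             real (card {d \<in> D k. d1 k \<le> real_of_int d \<and> real_of_int d \<le> d2 k})
               / real (card (D k)) \<ge> c))))"

definition delta_set :: "real set \<Rightarrow> real measure" where
  "delta_set A = distr (measure_pmf (pmf_of_set A)) borel (\<lambda>x. x)"

text \<open>mu_n = delta_{N_1^{-1}B_1} * ... * delta_{(N_n...N_1)^{-1}B_n}; sequences indexed from 0,
  so conv_partial N B n convolves the factors j = 0..n.\<close>
fun conv_partial :: "(nat \<Rightarrow> int) \<Rightarrow> (nat \<Rightarrow> int set) \<Rightarrow> nat \<Rightarrow> real measure" where
  "conv_partial N B 0 = delta_set ((\<lambda>b. real_of_int b / real_of_int (N 0)) ` B 0)"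
| "conv_partial N B (Suc n) = convolution (conv_partial N B n)
     (delta_set ((\<lambda>b. real_of_int b / real_of_int (\<Prod>j\<le>Suc n. N j)) ` B (Suc n)))"

definition weak_limit :: "(nat \<Rightarrow> real measure) \<Rightarrow> real measure \<Rightarrow> bool" where
  "weak_limit Ms M \<longleftrightarrow>
     (\<forall>f :: real \<Rightarrow> real. continuous_on UNIV f \<and> bounded (range f) \<longrightarrow>
        (\<lambda>n. integral\<^sup>L (Ms n) f) \<longlonglongrightarrow> integral\<^sup>L M f)"

definition expo :: "real \<Rightarrow> real \<Rightarrow> complex" where
  "expo u x = cis (- 2 * pi * u * x)"

text \<open>Spectral measure: {e_lambda : lambda in Lambda} is an orthonormal basis of L^2(mu):
  orthonormal, and complete (only the zero element of L^2(mu) is orthogonal to all e_lambda).\<close>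
definition spectral_measure :: "real measure \<Rightarrow> bool" where
  "spectral_measure m \<longleftrightarrow> (\<exists>Lam :: real set. countable Lam \<and>
     (\<forall>u\<in>Lam. \<forall>u'\<in>Lam. integral\<^sup>L m (\<lambda>x. expo u x * cnj (expo u' x)) = (if u = u' then 1 else 0)) \<and>
     (\<forall>f :: real \<Rightarrow> complex. f \<in> borel_measurable m \<and> integrable m (\<lambda>x. (cmod (f x))\<^sup>2) \<and>
        (\<forall>u\<in>Lam. integral\<^sup>L m (\<lambda>x. f x * cnj (expo u x)) = 0)
        \<longrightarrow> (AE x in m. f x = 0)))"

end

theory Submission
  imports Defs
begin

text \<open>
  The convolution of the first \<open>m\<close> factors has Fourier transform \<open>pft m\<close>, periodic with period
  \<open>P m = N\<^sub>0 \<cdots> N\<^sub>m\<^sub>-\<^sub>1\<close>, and the Hadamard matrices give finite integer sets satisfying its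
  Parseval identity. The full measure has transform \<open>pft m t * ft (nu m) (t / P m)\<close>, where \<open>nu m\<close>
  is the law of the rescaled tail. If along infinitely many \<open>m\<close> every real
  number has an integer translate near which \<open>ft (nu m)\<close> is at least a fixed positive constant, then the finite
  spectra can be shifted, by periodicity, into an increasing sequence along which no mass is lost in
  the limit, and their union is a spectrum.

  Otherwise Helly's theorem yields a limit \<open>M\<close> of the tails, carried by \<open>[0,1]\<close> because of the
  remainder bounded condition, whose transform vanishes on a coset \<open>u + \<int>\<close>. By the
  Stone-Weierstrass theorem on the circle, \<open>M\<close> gives mass 1/2 to each of 0 and 1. If \<open>N\<close> stays
  bounded along a subsequence this contradicts the integer zeros of the transforms of the tails, and
  if \<open>N\<close> tends to infinity it contradicts the partial concentration condition.
\<close>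

section \<open>Fourier transforms of distributions on the line\<close>

text \<open>The finite Parseval identities do not pass to the limit by themselves: Fatou's lemma
  only bounds the limiting sum of squares by 1, since weight may sit at frequencies where the factor
  \<open>ft (nu m)\<close> is small. A lower bound \<open>e\<close> for this factor dominates each
  finite summand by \<open>1 / e\<^sup>2\<close> times the limit summand, and that prevents the
  loss.

  Equal masses at 0 and 1 are a genuine obstruction. The two ends are one point of the circle, so
  functions on the circle cannot separate them, and the transform of this law does vanish on 1/2 +
  \<int>. It is excluded in two ways. Its transform is 1 at every integer, whereas a tail with
  leading base \<open>N m\<close> has a zero at an integer strictly between 0 and
  \<open>N m\<close>. And for large \<open>N m\<close> the leading digit over \<open>N m\<close>
  determines the tail up to \<open>1 / N m\<close>, so that the limit inherits the position of the
  digits: a window shorter than the whole range cannot feed both ends, and mass bounded away from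
  the ends stays there.\<close>

definition ft :: "real measure \<Rightarrow> real \<Rightarrow> complex" where
  "ft M t = (CLINT x|M. cis (2 * pi * t * x))"

lemma ft_eq_char: "ft M t = char M (2 * pi * t)"
  by (simp add: ft_def char_def cis_conv_exp)

lemma (in real_distribution) norm_ft_le_1: "cmod (ft M t) \<le> 1"
  by (simp add: ft_eq_char cmod_char_le_1)

lemma (in real_distribution) ft_zero [simp]: "ft M 0 = 1"
  using char_zero by (simp add: ft_eq_char)

lemma (in real_distribution) ft_minus: "ft M (- t) = cnj (ft M t)"
  unfolding ft_def by (subst Bochner_Integration.integral_cnj[symmetric]) (simp add: cis_cnj)

section \<open>Uniqueness of the Fourier transform of an integrable function\<close>

lemma cis_measurable [measurable]: "cis \<in> borel_measurable borel"
  by (intro borel_measurable_continuous_onI continuous_intros)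

lemma (in real_distribution) integrable_cis_mult [intro]:
  fixes f :: "real \<Rightarrow> complex"
  assumes "integrable M f"
  shows "integrable M (\<lambda>x. cis (a * x) * f x)" "integrable M (\<lambda>x. f x * cis (a * x))"
proof -
  have [measurable]: "f \<in> borel_measurable M" using assms by auto
  show "integrable M (\<lambda>x. cis (a * x) * f x)"
    by (rule Bochner_Integration.integrable_bound[OF assms]) (auto simp: norm_mult)
  then show "integrable M (\<lambda>x. f x * cis (a * x))" by (simp add: mult.commute)
qed

lemma (in real_distribution) integrable_cis [intro, simp]: "integrable M (\<lambda>x. cis (a * x))"
  using integrable_cis_mult(1)[of "\<lambda>_. 1"] by simp

text \<open>At \<open>t = 0\<close> the hypothesis gives the positive and negative parts equal mass.
  If this mass is positive, normalising yields two probability densities with the same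
  characteristic function, and Levy's uniqueness theorem identifies them.\<close>

lemma (in real_distribution) AE_zero_if_fourier_zero_real:
  fixes g :: "real \<Rightarrow> real"
  assumes g: "integrable M g"
    and zero: "\<And>t. (CLINT x|M. complex_of_real (g x) * iexp (t * x)) = 0"
  shows "AE x in M. g x = 0"
proof -
  have [measurable]: "g \<in> borel_measurable M" using g by auto
  then have gb [measurable]: "g \<in> borel_measurable borel" by simp
  define p where "p x = max 0 (g x)" for x
  define q where "q x = max 0 (- g x)" for x
  have pM [measurable]: "p \<in> borel_measurable borel" "q \<in> borel_measurable borel"
    unfolding p_def q_def by measurable
  have pint: "integrable M p" "integrable M q"
    using g unfolding p_def q_def by (auto intro!: integrable_max)
  have gpq: "g x = p x - q x" for x by (auto simp: p_def q_def)
  have pos: "p x \<ge> 0" "q x \<ge> 0" for x by (auto simp: p_def q_def)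
  define c where "c = (LINT x|M. p x)"
  have cq: "c = (LINT x|M. q x)"
  proof -
    have "complex_of_real (LINT x|M. g x) = 0"
      using zero[of 0] by simp
    then have "(LINT x|M. p x - q x) = 0" by (simp add: gpq)
    then show ?thesis using pint by (simp add: c_def)
  qed
  show ?thesis
  proof (cases "c = 0")
    case True
    have "AE x in M. p x = 0" "AE x in M. q x = 0"
      using integral_nonneg_eq_0_iff_AE[of M p] integral_nonneg_eq_0_iff_AE[of M q] pint pos True c_def cq
      by auto
    then show ?thesis by eventually_elim (simp add: gpq)
  next
    case False
    then have cpos: "c > 0" using pos by (simp add: c_def order_less_le)
    have rd: "real_distribution (density M (\<lambda>x. ennreal (r x / c)))"
      if [measurable]: "r \<in> borel_measurable borel" and r: "integrable M r" "\<And>x. r x \<ge> 0" "c = (LINT x|M. r x)" for r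
    proof -
      have "emeasure (density M (\<lambda>x. ennreal (r x / c))) UNIV = (\<integral>\<^sup>+ x. ennreal (r x / c) \<partial>M)"
        by (subst emeasure_density) auto
      also have "\<dots> = ennreal (LINT x|M. r x / c)"
        using r cpos by (intro nn_integral_eq_integral) auto
      also have "\<dots> = 1" using cpos r by simp
      finally show ?thesis
        by (intro real_distribution.intro prob_spaceI real_distribution_axioms.intro) auto
    qed
    have ch: "char (density M (\<lambda>x. ennreal (r x / c))) t = (CLINT x|M. complex_of_real (r x) * iexp (t * x)) / of_real c"
      if [measurable]: "r \<in> borel_measurable borel" and r: "\<And>x. r x \<ge> 0" for r t
    proof -
      have "char (density M (\<lambda>x. ennreal (r x / c))) t = (CLINT x|M. (r x / c) *\<^sub>R iexp (t * x))"
        unfolding char_def using r cpos by (subst integral_density) auto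
      also have "\<dots> = (CLINT x|M. (complex_of_real (r x) * iexp (t * x)) / of_real c)"
        by (simp add: scaleR_conv_of_real)
      finally show ?thesis by simp
    qed
    have "char (density M (\<lambda>x. ennreal (p x / c))) = char (density M (\<lambda>x. ennreal (q x / c)))"
    proof
      fix t
      have int: "integrable M (\<lambda>x. complex_of_real (r x) * iexp (t * x))" if "integrable M r" for r :: "real \<Rightarrow> real"
        using integrable_cis_mult(2)[of "\<lambda>x. complex_of_real (r x)" t] that by (simp add: cis_conv_exp)
      have "(CLINT x|M. complex_of_real (p x) * iexp (t * x)) - (CLINT x|M. complex_of_real (q x) * iexp (t * x)) = 0"
        using zero[of t] int[OF pint(1)] int[OF pint(2)]
        by (simp add: gpq left_diff_distrib flip: Bochner_Integration.integral_diff)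
      then show "char (density M (\<lambda>x. ennreal (p x / c))) t = char (density M (\<lambda>x. ennreal (q x / c))) t"
        using pos by (simp add: ch)
    qed
    then have "density M (\<lambda>x. ennreal (p x / c)) = density M (\<lambda>x. ennreal (q x / c))"
      using pint pos cq c_def by (intro Levy_uniqueness rd) auto
    then have "AE x in M. ennreal (p x / c) = ennreal (q x / c)"
      by (subst (asm) density_unique_iff) auto
    then show ?thesis
    proof eventually_elim
      case (elim x)
      then show ?case using cpos pos[of x] by (simp add: gpq)
    qed
  qed
qed

text \<open>Conjugating the hypothesis at \<open>- t\<close> shows that the transform of the
  conjugate of \<open>f\<close> vanishes too, so real and imaginary part fall under the real
  case.\<close>

lemma (in real_distribution) AE_zero_if_fourier_zero:
  fixes f :: "real \<Rightarrow> complex"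
  assumes f: "integrable M f" and zero: "\<And>t. (CLINT x|M. f x * cis (2 * pi * t * x)) = 0"
  shows "AE x in M. f x = 0"
proof -
  have z: "(CLINT x|M. f x * cis (t * x)) = 0" for t
    using zero[of "t / (2 * pi)"] by simp
  have zc: "(CLINT x|M. cnj (f x) * cis (t * x)) = 0" for t
  proof -
    have "(CLINT x|M. cnj (f x) * cis (t * x)) = (CLINT x|M. cnj (f x * cis (- t * x)))"
      by (simp add: cis_cnj)
    also have "\<dots> = cnj (CLINT x|M. f x * cis (- t * x))" by (rule Bochner_Integration.integral_cnj)
    also have "\<dots> = 0" using z[of "-t"] by simp
    finally show ?thesis .
  qed
  have fc: "integrable M (\<lambda>x. cnj (f x))" using f by simp
  have "AE x in M. Re (f x) = 0"
  proof (rule AE_zero_if_fourier_zero_real)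
    fix t
    have "(CLINT x|M. complex_of_real (Re (f x)) * iexp (t * x))
        = (CLINT x|M. (f x * cis (t * x) + cnj (f x) * cis (t * x)) / 2)"
      by (intro Bochner_Integration.integral_cong refl)
         (simp add: cis_conv_exp complex_add_cnj flip: distrib_right)
    also have "\<dots> = 0" using integrable_cis_mult(2)[OF f] integrable_cis_mult(2)[OF fc] z zc by simp
    finally show "(CLINT x|M. complex_of_real (Re (f x)) * iexp (t * x)) = 0" .
  qed (use f in auto)
  moreover have "AE x in M. Im (f x) = 0"
  proof (rule AE_zero_if_fourier_zero_real)
    fix t
    have "(CLINT x|M. complex_of_real (Im (f x)) * iexp (t * x))
        = (CLINT x|M. (f x * cis (t * x) - cnj (f x) * cis (t * x)) * (- \<i> / 2))"
      by (intro Bochner_Integration.integral_cong refl)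
         (simp add: complex_eq_iff field_simps flip: cis_conv_exp of_real_mult)
    also have "\<dots> = 0" using integrable_cis_mult(2)[OF f] integrable_cis_mult(2)[OF fc] z zc by simp
    finally show "(CLINT x|M. complex_of_real (Im (f x)) * iexp (t * x)) = 0" .
  qed (use f in auto)
  ultimately show ?thesis by eventually_elim (simp add: complex_eq_iff)
qed

section \<open>Trigonometric polynomials and measures on the circle\<close>

inductive trig_poly :: "(real \<Rightarrow> complex) \<Rightarrow> bool" where
  monom: "trig_poly (\<lambda>t. c * cis (2 * pi * real_of_int j * t))"
| add: "trig_poly f \<Longrightarrow> trig_poly g \<Longrightarrow> trig_poly (\<lambda>t. f t + g t)"

lemma trig_poly_monom_mult:
  "trig_poly f \<Longrightarrow> trig_poly (\<lambda>t. c * cis (2 * pi * real_of_int j * t) * f t)"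
proof (induction rule: trig_poly.induct)
  case (monom d k)
  have "(\<lambda>t. c * cis (2 * pi * real_of_int j * t) * (d * cis (2 * pi * real_of_int k * t)))
     = (\<lambda>t. (c * d) * cis (2 * pi * real_of_int (j + k) * t))"
  proof
    fix t
    have "cis (2 * pi * real_of_int (j + k) * t) = cis (2 * pi * real_of_int j * t) * cis (2 * pi * real_of_int k * t)"
      unfolding cis_mult by (simp add: algebra_simps)
    then show "c * cis (2 * pi * real_of_int j * t) * (d * cis (2 * pi * real_of_int k * t)) = (c * d) * cis (2 * pi * real_of_int (j + k) * t)"
      by (simp only: mult_ac)
  qed
  then show ?case by (metis trig_poly.monom)
next
  case (add f g)
  then show ?case using trig_poly.add by (simp add: distrib_left)
qed

lemma trig_poly_mult: "trig_poly f \<Longrightarrow> trig_poly g \<Longrightarrow> trig_poly (\<lambda>t. f t * g t)"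
proof (induction rule: trig_poly.induct)
  case (monom c j)
  then show ?case by (rule trig_poly_monom_mult)
next
  case (add f1 f2)
  then show ?case using trig_poly.add by (simp add: distrib_right)
qed

text \<open>The generators suffice: a real-linear form on the plane is a combination of
  \<open>z\<close> and \<open>cnj z\<close>, which on the circle are the monomials with
  \<open>j = 1\<close> and \<open>j = -1\<close>.\<close>

lemma trig_poly_real_polynomial_cis:
  fixes q :: "complex \<Rightarrow> real"
  shows "real_polynomial_function q \<Longrightarrow> trig_poly (\<lambda>t. complex_of_real (q (cis (2 * pi * t))))"
proof (induction rule: real_polynomial_function.induct)
  case (linear f)
  interpret bounded_linear f by fact
  have *: "complex_of_real (f (cis (2 * pi * t)))
     = (of_real (f 1) / 2 - \<i> * of_real (f \<i>) / 2) * cis (2 * pi * real_of_int 1 * t)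
      + (of_real (f 1) / 2 + \<i> * of_real (f \<i>) / 2) * cis (2 * pi * real_of_int (-1) * t)" for t
  proof -
    have "cis (2 * pi * t) = cos (2 * pi * t) *\<^sub>R 1 + sin (2 * pi * t) *\<^sub>R \<i>"
      by (simp add: complex_eq_iff)
    then have "f (cis (2 * pi * t)) = cos (2 * pi * t) * f 1 + sin (2 * pi * t) * f \<i>"
      by (simp only: add scaleR) simp
    then show ?thesis by (simp add: complex_eq_iff algebra_simps)
  qed
  show ?case unfolding * by (intro trig_poly.intros)
next
  case (const c)
  show ?case using trig_poly.monom[of "of_real c" 0] by simp
next
  case (add f g)
  then show ?case using trig_poly.add by simp
next
  case (mult f g)
  then show ?case using trig_poly_mult by simp
qed

text \<open>The factor \<open>cis (2 * pi * u * t)\<close> is in general no function on the circle,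
  so it is kept with the measure. The resulting complex measure, pushed to the circle, has vanishing
  Fourier coefficients, and uniform approximation by trigonometric polynomials does the
  rest.\<close>

lemma (in real_distribution) integral_circle_eq_0:
  fixes G :: "complex \<Rightarrow> real"
  assumes zero: "\<And>j::int. ft M (u + real_of_int j) = 0"
    and G: "continuous_on UNIV G"
  shows "(CLINT t|M. cis (2 * pi * u * t) * complex_of_real (G (cis (2 * pi * t)))) = 0"
proof -
  have Gm [measurable]: "G \<in> borel_measurable borel"
    using G by (rule borel_measurable_continuous_onI)
  have Gint: "integrable M (\<lambda>t. complex_of_real (H (cis (2 * pi * t))))"
    if H: "continuous_on UNIV H" for H :: "complex \<Rightarrow> real"
  proof -
    have [measurable]: "H \<in> borel_measurable borel"
      using H by (rule borel_measurable_continuous_onI)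
    have "compact (H ` sphere 0 1)"
      using continuous_on_subset[OF H] by (intro compact_continuous_image) auto
    then have "bounded (H ` sphere 0 1)"
      by (rule compact_imp_bounded)
    then obtain K where K: "\<And>z. z \<in> sphere 0 1 \<Longrightarrow> norm (H z) \<le> K"
      unfolding bounded_iff by (metis imageI)
    show ?thesis
    proof (rule integrable_const_bound[of _ K])
      show "AE t in M. norm (complex_of_real (H (cis (2 * pi * t)))) \<le> K"
        using K[of "cis (2 * pi * t)" for t] by simp
    qed measurable
  qed
  have trig: "integrable M (\<lambda>t. cis (2 * pi * u * t) * f t) \<and> (CLINT t|M. cis (2 * pi * u * t) * f t) = 0"
    if "trig_poly f" for f
    using that
  proof induction
    case (monom c j)
    have *: "cis (2 * pi * u * t) * (c * cis (2 * pi * real_of_int j * t)) = c * cis ((2 * pi * (u + real_of_int j)) * t)" for t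
    proof -
      have "cis (2 * pi * (u + real_of_int j) * t) = cis (2 * pi * u * t) * cis (2 * pi * real_of_int j * t)"
        unfolding cis_mult by (simp add: algebra_simps)
      then show ?thesis by (simp only: mult_ac)
    qed
    show ?case unfolding * using zero[of j] unfolding ft_def by simp
  next
    case (add f g)
    then show ?case by (simp add: distrib_left)
  qed
  have small: "cmod (CLINT t|M. cis (2 * pi * u * t) * complex_of_real (G (cis (2 * pi * t)))) \<le> e" if e: "e > 0" for e
  proof -
    obtain q where q: "real_polynomial_function q" "\<And>z. z \<in> sphere (0::complex) 1 \<Longrightarrow> \<bar>G z - q z\<bar> < e"
      by (rule Stone_Weierstrass_real_polynomial_function
          [OF compact_sphere[of "0::complex" 1] continuous_on_subset[OF G subset_UNIV] e]) (rule that)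
    have qc: "continuous_on UNIV q"
      using q(1) continuous_on_polymonial_function real_polynomial_function_eq by blast
    have qm [measurable]: "q \<in> borel_measurable borel"
      using qc by (rule borel_measurable_continuous_onI)
    note tq = trig[OF trig_poly_real_polynomial_cis[OF q(1)]]
    have iG: "integrable M (\<lambda>t. cis (2 * pi * u * t) * complex_of_real (G (cis (2 * pi * t))))"
      by (rule integrable_cis_mult(1)[OF Gint[OF G]])
    have "cmod (CLINT t|M. cis (2 * pi * u * t) * complex_of_real (G (cis (2 * pi * t))))
      = cmod (CLINT t|M. cis (2 * pi * u * t) * complex_of_real (G (cis (2 * pi * t))) - cis (2 * pi * u * t) * complex_of_real (q (cis (2 * pi * t))))"
      using tq iG by simp
    also have "\<dots> \<le> (LINT t|M. cmod (cis (2 * pi * u * t) * complex_of_real (G (cis (2 * pi * t))) - cis (2 * pi * u * t) * complex_of_real (q (cis (2 * pi * t)))))"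
      by (rule integral_norm_bound)
    also have "\<dots> \<le> (LINT t|M. e)"
    proof (rule integral_mono)
      show "integrable M (\<lambda>t. cmod (cis (2 * pi * u * t) * complex_of_real (G (cis (2 * pi * t))) - cis (2 * pi * u * t) * complex_of_real (q (cis (2 * pi * t)))))"
        by (rule integrable_norm[OF Bochner_Integration.integrable_diff[OF iG conjunct1[OF tq]]])
      fix t
      have "cmod (c * complex_of_real x - c * complex_of_real y) = \<bar>x - y\<bar>" if "cmod c = 1" for c x y
      proof -
        have "c * complex_of_real x - c * complex_of_real y = c * complex_of_real (x - y)"
          by (simp add: right_diff_distrib)
        then show ?thesis by (simp only: norm_mult that norm_of_real mult_1)
      qed
      then show "cmod (cis (2 * pi * u * t) * complex_of_real (G (cis (2 * pi * t))) - cis (2 * pi * u * t) * complex_of_real (q (cis (2 * pi * t)))) \<le> e"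
        using less_imp_le[OF q(2)[of "cis (2 * pi * t)"]] by (simp only: norm_cis mem_sphere_0)
    qed auto
    also have "\<dots> = e" using prob_space by simp
    finally show ?thesis .
  qed
  have "cmod (CLINT t|M. cis (2 * pi * u * t) * complex_of_real (G (cis (2 * pi * t)))) \<le> 0"
    by (rule field_le_epsilon) (use small in auto)
  then show ?thesis by simp
qed

text \<open>The cosine decreases in the distance of \<open>d\<close> to the nearest integer, and the
  hypotheses put that distance at \<open>r\<close> or more.\<close>

lemma cos_2pi_le_cos_2pi:
  assumes "0 \<le> r" "r \<le> \<bar>d\<bar>" "\<bar>d\<bar> \<le> 1 - r"
  shows "cos (2 * pi * d) \<le> cos (2 * pi * r)"
proof -
  have *: "cos (2 * pi * y) \<le> cos (2 * pi * r)" if "r \<le> y" "y \<le> 1/2" for y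
    using that assms by (intro cos_monotone_0_pi_le) auto
  have abs: "cos (2 * pi * d) = cos (2 * pi * \<bar>d\<bar>)"
    using cos_abs_real[of "2 * pi * d"] by (simp add: abs_mult)
  show ?thesis
  proof (cases "\<bar>d\<bar> \<le> 1/2")
    case True
    then show ?thesis using *[of "\<bar>d\<bar>"] assms abs by simp
  next
    case False
    have "cos (2 * pi * (1 - \<bar>d\<bar>)) = cos (2 * pi * \<bar>d\<bar>)"
      by (simp add: right_diff_distrib cos_diff)
    then show ?thesis using *[of "1 - \<bar>d\<bar>"] False assms abs by simp
  qed
qed

text \<open>A bump on the circle supported in an arc around \<open>c\<close> so short that \<open>cis (2\<pi>u(t-c))\<close> has
  positive real part there; vanishing of its integral makes the arc a null set.\<close>

lemma (in real_distribution) AE_not_near_if_ft_zero: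
  assumes supp: "AE t in M. 0 \<le> t \<and> t \<le> 1"
    and u: "0 \<le> u" "u \<le> 1" and zero: "\<And>j::int. ft M (u + real_of_int j) = 0"
    and r: "0 < r" "r \<le> c" "r \<le> 1 - c" "r \<le> 1/6"
  shows "AE t in M. \<not> \<bar>t - c\<bar> < r"
proof -
  \<comment> \<open>The positive part of \<open>cos (2 * pi * (t - c)) - cos (2 * pi * r)\<close> as
    a function on the circle: positive exactly on the open arc of radius \<open>r\<close> around
    \<open>c\<close>.\<close>
  define G where "G z = max 0 (Re (z * cis (- (2 * pi * c))) - cos (2 * pi * r))" for z
  have Gc: "continuous_on UNIV G" unfolding G_def by (intro continuous_intros)
  then have Gm [measurable]: "G \<in> borel_measurable borel" by (rule borel_measurable_continuous_onI)
  have Geq: "G (cis (2 * pi * t)) = max 0 (cos (2 * pi * (t - c)) - cos (2 * pi * r))" for t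
  proof -
    have "cis (2 * pi * t) * cis (- (2 * pi * c)) = cis (2 * pi * (t - c))"
      unfolding cis_mult by (simp add: algebra_simps)
    then show ?thesis unfolding G_def by (simp only: cis.simps)
  qed
  define h where "h t = cos (2 * pi * u * (t - c)) * G (cis (2 * pi * t))" for t
  have hm [measurable]: "h \<in> borel_measurable borel" unfolding h_def by measurable
  have Gb: "\<bar>G (cis (2 * pi * t))\<bar> \<le> 2" for t
    unfolding Geq using cos_le_one[of "2 * pi * (t - c)"] cos_ge_minus_one[of "2 * pi * r"] by linarith
  have hint: "integrable M h"
  proof (rule integrable_const_bound[of _ 2])
    show "AE t in M. norm (h t) \<le> 2"
      using Gb by (intro AE_I2) (auto simp: h_def abs_mult intro: order_trans[OF mult_left_le_one_le])
  qed auto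
  have "(LINT t|M. h t) = Re (cis (- (2 * pi * u * c)) * (CLINT t|M. cis (2 * pi * u * t) * complex_of_real (G (cis (2 * pi * t)))))"
  proof -
    have Gi: "integrable M (\<lambda>t. complex_of_real (G (cis (2 * pi * t))))"
      by (rule integrable_const_bound[of _ 2]) (use Gb in auto)
    have "h t = Re (cis (- (2 * pi * u * c)) * (cis (2 * pi * u * t) * complex_of_real (G (cis (2 * pi * t)))))" for t
    proof -
      have "cis (- (2 * pi * u * c)) * cis (2 * pi * u * t) = cis (2 * pi * u * (t - c))"
        unfolding cis_mult by (simp add: algebra_simps)
      then show ?thesis unfolding h_def by (simp only: mult.assoc[symmetric]) simp
    qed
    then have "(LINT t|M. h t) = (LINT t|M. Re (cis (- (2 * pi * u * c)) * (cis (2 * pi * u * t) * complex_of_real (G (cis (2 * pi * t))))))"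
      by simp
    also have "\<dots> = Re (CLINT t|M. cis (- (2 * pi * u * c)) * (cis (2 * pi * u * t) * complex_of_real (G (cis (2 * pi * t)))))"
      by (rule integral_Re) (intro integrable_mult_right integrable_cis_mult(1) Gi)
    also have "\<dots> = Re (cis (- (2 * pi * u * c)) * (CLINT t|M. cis (2 * pi * u * t) * complex_of_real (G (cis (2 * pi * t)))))"
      by simp
    finally show ?thesis .
  qed
  then have h0: "(LINT t|M. h t) = 0"
    using integral_circle_eq_0[OF zero Gc] by simp
  have cospos: "cos (2 * pi * u * (t - c)) > 0" if "\<bar>t - c\<bar> < r" for t
  proof (rule cos_gt_zero_pi)
    have "\<bar>2 * pi * u * (t - c)\<bar> = 2 * pi * (u * \<bar>t - c\<bar>)" using u by (simp add: abs_mult)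
    \<comment> \<open>The bound 1/6 on \<open>r\<close> keeps the angle within pi/3, where the
      cosine is positive.\<close>
    also have "\<dots> \<le> 2 * pi * (1 * (1/6))" using that r u by (intro mult_left_mono mult_mono) auto
    also have "\<dots> < pi / 2" by simp
    finally show "2 * pi * u * (t - c) < pi / 2" "- (pi / 2) < 2 * pi * u * (t - c)" by linarith+
  qed
  have pos: "AE t in M. 0 \<le> h t"
    using supp
  proof eventually_elim
    case (elim t)
    show ?case
    proof (cases "\<bar>t - c\<bar> < r")
      case True
      then show ?thesis using cospos[OF True] unfolding h_def Geq by (intro mult_nonneg_nonneg) auto
    next
      case False
      \<comment> \<open>\<open>r \<le> c\<close> and \<open>r \<le> 1 - c\<close> keep
        \<open>\<bar>t - c\<bar>\<close> at most \<open>1 - r\<close> on [0,1]: a point off the arc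
        on the line is also off it on the circle.\<close>
      then have "cos (2 * pi * (t - c)) \<le> cos (2 * pi * r)" using elim r by (intro cos_2pi_le_cos_2pi) auto
      then show ?thesis by (simp add: h_def Geq)
    qed
  qed
  have "AE t in M. h t = 0" using integral_nonneg_eq_0_iff_AE[OF hint pos] h0 by simp
  then show ?thesis
  proof eventually_elim
    case (elim t)
    show ?case
    proof
      assume t: "\<bar>t - c\<bar> < r"
      have "cos (2 * pi * \<bar>t - c\<bar>) > cos (2 * pi * r)"
        using t r by (intro cos_monotone_0_pi) auto
      moreover have "cos (2 * pi * (t - c)) = cos (2 * pi * \<bar>t - c\<bar>)" 
        using cos_abs_real[of "2 * pi * (t - c)"] by (simp add: abs_mult)
      ultimately show False using elim cospos[OF t] by (auto simp: h_def Geq max_def split: if_splits)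
    qed
  qed
qed

text \<open>Countably many null arcs with rational centres cover the open interval, and the zero at
  \<open>u\<close> forces the two remaining masses to have equal modulus. Vector-valued
  \<open>G\<close> lets the formula serve complex exponentials as well as real test
  functions.\<close>

lemma (in real_distribution) two_point_if_ft_zero:
  fixes G :: "real \<Rightarrow> 'b::{banach, second_countable_topology}"
  assumes supp: "AE t in M. 0 \<le> t \<and> t \<le> 1"
    and u: "0 \<le> u" "u \<le> 1" and zero: "\<And>j::int. ft M (u + real_of_int j) = 0"
    and G: "G \<in> borel_measurable borel"
  shows "integral\<^sup>L M G = (1/2) *\<^sub>R G 0 + (1/2) *\<^sub>R G 1"
proof -
  define r where "r c = min (min c (1 - c)) (1/6)" for c :: real
  have "AE t in M. \<forall>c\<in>\<rat> \<inter> {0<..<1}. \<not> \<bar>t - c\<bar> < r c"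
  proof (subst AE_ball_countable)
    show "countable (\<rat> \<inter> {0<..<1::real})" using countable_rat by (rule countable_subset[rotated]) auto
    show "\<forall>c\<in>\<rat> \<inter> {0<..<1}. AE t in M. \<not> \<bar>t - c\<bar> < r c"
    proof
      fix c :: real assume "c \<in> \<rat> \<inter> {0<..<1}"
      then have "0 < r c" "r c \<le> c" "r c \<le> 1 - c" "r c \<le> 1/6" unfolding r_def greaterThanLessThan_iff Int_iff by linarith+
      then show "AE t in M. \<not> \<bar>t - c\<bar> < r c" by (rule AE_not_near_if_ft_zero[OF supp u zero])
    qed
  qed
  with supp have ends: "AE t in M. t = 0 \<or> t = 1"
  proof eventually_elim
    case (elim t)
    show ?case
    proof (rule ccontr)
      assume "\<not> (t = 0 \<or> t = 1)"
      then have t: "0 < t" "t < 1" using elim by auto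
      \<comment> \<open>The factor 1/2 makes \<open>d\<close> smaller than the radius
        \<open>r c\<close> at every \<open>c\<close> between \<open>t - d\<close> and
        \<open>t\<close>.\<close>
      define d where "d = min (min t (1 - t)) (1/6) / 2"
      have "d > 0" using t by (auto simp: d_def)
      then obtain c where c: "c \<in> \<rat>" "t - d < c" "c < t"
        using Rats_dense_in_real[of "t - d" t] by auto
      have "d \<le> t / 2" "d \<le> (1 - t) / 2" "d \<le> 1 / 12" unfolding d_def by (auto simp: min_def)
      note c = c this
      have "c > 0" using c t by linarith
      moreover have "c < 1" using c t by linarith
      moreover have "\<bar>t - c\<bar> < r c" using c t by (auto simp: r_def)
      ultimately show False using elim c(1) by (meson IntI greaterThanLessThan_iff)
    qed
  qed
  have int: "integral\<^sup>L M H = prob {0} *\<^sub>R H 0 + prob {1} *\<^sub>R H 1"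
    if [measurable]: "H \<in> borel_measurable borel" for H :: "real \<Rightarrow> 'c::{banach, second_countable_topology}"
  proof -
    have "integral\<^sup>L M H = (LINT t|M. indicator {0} t *\<^sub>R H 0 + indicator {1} t *\<^sub>R H 1)"
      by (rule integral_cong_AE) (use ends in \<open>auto elim!: eventually_mono split: split_indicator\<close>)
    also have "\<dots> = (LINT t|M. indicator {0} t *\<^sub>R H 0) + (LINT t|M. indicator {1} t *\<^sub>R H 1)"
      by (rule Bochner_Integration.integral_add) (auto intro!: integrable_scaleR_left integrable_real_indicator simp: less_top[symmetric])
    also have "\<dots> = prob {0} *\<^sub>R H 0 + prob {1} *\<^sub>R H 1"
      by (simp add: less_top[symmetric])
    finally show ?thesis .
  qed
  have "ft M u = of_real (prob {0}) + of_real (prob {1}) * cis (2 * pi * u)"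
    unfolding ft_def by (subst int) (auto simp: scaleR_conv_of_real)
  then have "of_real (prob {0}) = - (of_real (prob {1}) * cis (2 * pi * u))"
    using zero[of 0] by (simp add: eq_neg_iff_add_eq_0)
  then have "cmod (of_real (prob {0})) = cmod (of_real (prob {1}) * cis (2 * pi * u))"
    by (metis norm_minus_cancel)
  then have "prob {0} = prob {1}" by (simp add: norm_mult)
  moreover have "prob {0} + prob {1} = 1"
    using int[of "\<lambda>_. 1::real"] prob_space by simp
  ultimately have "prob {0} = 1/2" "prob {1} = 1/2" by linarith+
  then show ?thesis using int[OF G] by (simp only:)
qed

section \<open>Spectrality from an approximate Parseval equality\<close>

lemma expo_mult_cnj_expo: "expo u x * cnj (expo v x) = cis (2 * pi * (v - u) * x)"
  unfolding expo_def cis_cnj cis_mult by (simp add: algebra_simps)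

lemma (in real_distribution) integral_expo_mult_cnj_expo:
  "(CLINT x|M. expo u x * cnj (expo v x)) = ft M (v - u)"
  unfolding expo_mult_cnj_expo ft_def ..

text \<open>Parseval's equality for the exponentials puts every exponential into the closed span of those
  with frequency in \<open>Lam\<close>, and a function orthogonal to all exponentials vanishes.\<close>

lemma (in real_distribution) spectral_measureI:
  assumes count: "countable Lam"
    and orth: "\<And>u v. u \<in> Lam \<Longrightarrow> v \<in> Lam \<Longrightarrow> u \<noteq> v \<Longrightarrow> ft M (u - v) = 0"
    and total: "\<And>w e. e > 0 \<Longrightarrow> \<exists>F. finite F \<and> F \<subseteq> Lam \<and> (\<Sum>u\<in>F. (cmod (ft M (u - w)))\<^sup>2) > 1 - e"
  shows "spectral_measure M"
  unfolding spectral_measure_def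
proof (intro exI[of _ Lam] conjI ballI allI impI count)
  fix u v assume "u \<in> Lam" "v \<in> Lam"
  then show "(CLINT x|M. expo u x * cnj (expo v x)) = (if u = v then 1 else 0)"
    unfolding integral_expo_mult_cnj_expo using orth[of v u] by auto
next
  fix f :: "real \<Rightarrow> complex"
  assume "f \<in> borel_measurable M \<and> integrable M (\<lambda>x. (cmod (f x))\<^sup>2) \<and>
    (\<forall>u\<in>Lam. (CLINT x|M. f x * cnj (expo u x)) = 0)"
  then have fm [measurable]: "f \<in> borel_measurable M" and f2: "integrable M (\<lambda>x. (cmod (f x))\<^sup>2)"
    and f0: "\<And>u. u \<in> Lam \<Longrightarrow> (CLINT x|M. f x * cnj (expo u x)) = 0" by auto
  have [measurable]: "expo u \<in> borel_measurable borel" for u unfolding expo_def by measurable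
  have [measurable]: "cnj \<in> borel_measurable borel"
    by (intro borel_measurable_continuous_onI continuous_intros)
  have ne: "cmod (expo u x) = 1" for u x by (simp add: expo_def)
  have fint: "integrable M f"
  proof (rule Bochner_Integration.integrable_bound[of M "\<lambda>x. 1 + (cmod (f x))\<^sup>2"])
    have "norm (f x) \<le> norm (1 + (cmod (f x))\<^sup>2)" for x
    proof -
      have "2 * cmod (f x) \<le> 1 + (cmod (f x))\<^sup>2" using sum_squares_bound[of 1 "cmod (f x)"] by simp
      moreover have "0 \<le> cmod (f x)" by simp
      ultimately have "cmod (f x) \<le> 1 + (cmod (f x))\<^sup>2" by linarith
      then show ?thesis by simp
    qed
    then show "AE x in M. norm (f x) \<le> norm (1 + (cmod (f x))\<^sup>2)" by simp
  qed (use f2 in auto)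
  have fe: "integrable M (\<lambda>x. f x * cnj (expo u x))" for u
    by (rule Bochner_Integration.integrable_bound[OF fint]) (auto simp: norm_mult ne)
  define A where "A = (LINT x|M. (cmod (f x))\<^sup>2)"
  have bound: "cmod (CLINT x|M. f x * cnj (expo w x)) \<le> t * (A + 1) / 2" if t: "t > 0" for w t
  proof -
    obtain F where F: "finite F" "F \<subseteq> Lam" "(\<Sum>u\<in>F. (cmod (ft M (u - w)))\<^sup>2) > 1 - t\<^sup>2"
      using total[of "t\<^sup>2" w] t by auto
    define c where "c u = ft M (u - w)" for u
    \<comment> \<open>\<open>c u\<close> is the inner product of \<open>expo w\<close> with
      \<open>expo u\<close>, so \<open>g\<close> is the residual of the orthogonal projection onto
      the span over \<open>F\<close>.\<close>
    define g where "g x = expo w x - (\<Sum>u\<in>F. c u * expo u x)" for x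
    have gm [measurable]: "g \<in> borel_measurable borel" unfolding g_def by measurable
    have gb: "cmod (g x) \<le> 1 + (\<Sum>u\<in>F. cmod (c u))" for x
      unfolding g_def
      by (rule order_trans[OF norm_triangle_ineq4])
         (auto intro!: add_mono order_trans[OF norm_sum] sum_mono simp: norm_mult ne)
    have ee: "integrable M (\<lambda>x. expo u x * cnj (expo v x))" for u v
      unfolding expo_mult_cnj_expo by (rule integrable_cis)
    have ge: "integrable M (\<lambda>x. g x * cnj (expo v x))" for v
      by (rule integrable_const_bound[of _ "1 + (\<Sum>u\<in>F. cmod (c u))"]) (auto simp: norm_mult ne gb)
    have Ig: "(CLINT x|M. g x * cnj (expo v x)) = ft M (v - w) - (\<Sum>u\<in>F. c u * ft M (v - u))" for v
    proof -
      have "g x * cnj (expo v x) = expo w x * cnj (expo v x) - (\<Sum>u\<in>F. c u * (expo u x * cnj (expo v x)))" for x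
        by (simp add: g_def left_diff_distrib sum_distrib_right mult.assoc)
      then have "(CLINT x|M. g x * cnj (expo v x))
        = (CLINT x|M. expo w x * cnj (expo v x)) - (\<Sum>u\<in>F. c u * (CLINT x|M. expo u x * cnj (expo v x)))"
        using ee by simp
      then show ?thesis by (simp only: integral_expo_mult_cnj_expo)
    qed
    have gF: "(CLINT x|M. g x * cnj (expo v x)) = 0" if v: "v \<in> F" for v
    proof -
      have "(\<Sum>u\<in>F. c u * ft M (v - u)) = (\<Sum>u\<in>F. if u = v then c v else 0)"
        using orth[of v] v F(2) by (intro sum.cong) (auto simp: subset_iff)
      then show ?thesis using v F(1) by (simp add: Ig c_def)
    qed
    \<comment> \<open>Pythagoras: \<open>gF\<close> removes the cross terms. The choice of
      \<open>F\<close> then makes the squared norm of \<open>g\<close> at most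
      \<open>t\<^sup>2\<close>.\<close>
    have gg: "(CLINT x|M. g x * cnj (g x)) = 1 - (\<Sum>u\<in>F. c u * cnj (c u))"
    proof -
      have "g x * cnj (g x) = g x * cnj (expo w x) - (\<Sum>u\<in>F. cnj (c u) * (g x * cnj (expo u x)))" for x
      proof -
        have "cnj (g x) = cnj (expo w x) - (\<Sum>u\<in>F. cnj (c u) * cnj (expo u x))"
          by (simp add: g_def)
        then show ?thesis by (simp add: right_diff_distrib sum_distrib_left mult_ac)
      qed
      then have "(CLINT x|M. g x * cnj (g x))
         = (CLINT x|M. g x * cnj (expo w x)) - (\<Sum>u\<in>F. cnj (c u) * (CLINT x|M. g x * cnj (expo u x)))"
        using ge by simp
      also have "\<dots> = 1 - (\<Sum>u\<in>F. c u * ft M (w - u))"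
        using gF by (simp add: Ig[of w])
      also have "(\<Sum>u\<in>F. c u * ft M (w - u)) = (\<Sum>u\<in>F. c u * cnj (c u))"
        unfolding c_def ft_minus[symmetric] by simp
      finally show ?thesis .
    qed
    have g2i: "integrable M (\<lambda>x. (cmod (g x))\<^sup>2)"
      by (rule integrable_const_bound[of _ "(1 + (\<Sum>u\<in>F. cmod (c u)))\<^sup>2"]) (auto intro!: power_mono gb)
    have "complex_of_real (LINT x|M. (cmod (g x))\<^sup>2) = complex_of_real (1 - (\<Sum>u\<in>F. (cmod (c u))\<^sup>2))"
      using gg by (simp add: complex_norm_square[symmetric] flip: of_real_power of_real_sum)
    then have "(LINT x|M. (cmod (g x))\<^sup>2) = 1 - (\<Sum>u\<in>F. (cmod (c u))\<^sup>2)"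
      unfolding of_real_eq_iff .
    then have g2: "(LINT x|M. (cmod (g x))\<^sup>2) \<le> t\<^sup>2" using F(3) by (simp add: c_def)
    have fg: "integrable M (\<lambda>x. f x * cnj (g x))"
    proof (rule Bochner_Integration.integrable_bound[of M "\<lambda>x. (1 + (\<Sum>u\<in>F. cmod (c u))) * f x"])
      have "norm (f x * cnj (g x)) \<le> norm (complex_of_real (1 + (\<Sum>u\<in>F. cmod (c u))) * f x)" for x
      proof -
        have "0 \<le> 1 + (\<Sum>u\<in>F. cmod (c u))" by (simp add: sum_nonneg add_nonneg_nonneg)
        then show ?thesis
          using mult_right_mono[OF gb[of x] norm_ge_zero[of "f x"]]
          unfolding norm_mult norm_of_real complex_mod_cnj by (simp add: mult.commute)
      qed
      then show "AE x in M. norm (f x * cnj (g x)) \<le> norm (complex_of_real (1 + (\<Sum>u\<in>F. cmod (c u))) * f x)" by simp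
    qed (use fint in auto)
    have "f x * cnj (expo w x) = f x * cnj (g x) + (\<Sum>u\<in>F. cnj (c u) * (f x * cnj (expo u x)))" for x
    proof -
      have "cnj (expo w x) = cnj (g x) + (\<Sum>u\<in>F. cnj (c u) * cnj (expo u x))"
        by (simp add: g_def)
      then show ?thesis by (simp add: distrib_left sum_distrib_left mult_ac)
    qed
    then have "(CLINT x|M. f x * cnj (expo w x))
        = (CLINT x|M. f x * cnj (g x)) + (\<Sum>u\<in>F. cnj (c u) * (CLINT x|M. f x * cnj (expo u x)))"
      using fe fg by simp
    then have "cmod (CLINT x|M. f x * cnj (expo w x)) = cmod (CLINT x|M. f x * cnj (g x))"
      using f0 F(2) by (simp add: subset_iff)
    also have "\<dots> \<le> (LINT x|M. cmod (f x * cnj (g x)))"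
      by (rule integral_norm_bound)
    \<comment> \<open>Cauchy-Schwarz in the weighted form
      \<open>2 * a * b \<le> t * a\<^sup>2 + b\<^sup>2 / t\<close>; with a residual of norm at most
      \<open>t\<close> both terms are of order \<open>t\<close>.\<close>
    also have "\<dots> \<le> (LINT x|M. (t * (cmod (f x))\<^sup>2 + (cmod (g x))\<^sup>2 / t) / 2)"
    proof (rule integral_mono)
      fix x
      let ?a = "cmod (f x)" and ?b = "cmod (g x)"
      have "0 \<le> (t * ?a - ?b)\<^sup>2 / t" using t by simp
      also have "\<dots> = t * ?a\<^sup>2 + ?b\<^sup>2 / t - 2 * (?a * ?b)"
        using t by (simp add: power2_eq_square field_simps)
      finally show "cmod (f x * cnj (g x)) \<le> (t * ?a\<^sup>2 + ?b\<^sup>2 / t) / 2" by (simp add: norm_mult)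
    qed (use fg f2 g2i in auto)
    also have "\<dots> = (t * A + (LINT x|M. (cmod (g x))\<^sup>2) / t) / 2"
      using f2 g2i by (simp add: A_def)
    also have "\<dots> \<le> (t * A + t\<^sup>2 / t) / 2"
      using g2 t by (intro divide_right_mono add_left_mono) auto
    also have "\<dots> = t * (A + 1) / 2" using t by (simp add: power2_eq_square distrib_left)
    finally show ?thesis .
  qed
  have "(CLINT x|M. f x * cis (2 * pi * w * x)) = 0" for w
  proof -
    have A0: "A \<ge> 0" by (simp add: A_def)
    have "cmod (CLINT x|M. f x * cnj (expo w x)) \<le> 0 + e" if "e > 0" for e
    proof -
      have "e / (A + 1) * (A + 1) / 2 = e / 2" using A0 by simp
      then show ?thesis using bound[of "e / (A + 1)" w] that A0 by simp
    qed
    then have "cmod (CLINT x|M. f x * cnj (expo w x)) \<le> 0" by (rule field_le_epsilon)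
    then show ?thesis by (simp add: expo_def cis_cnj)
  qed
  then show "AE x in M. f x = 0" by (rule AE_zero_if_fourier_zero[OF fint])
qed

section \<open>Finite spectra of the partial convolutions\<close>

text \<open>The Fourier transform of the uniform distribution on \<open>A\<close>; the digits being
  integers, it has period 1.\<close>

definition mask_poly :: "int set \<Rightarrow> real \<Rightarrow> complex" where
  "mask_poly A t = (\<Sum>a\<in>A. cis (2 * pi * real_of_int a * t)) / of_nat (card A)"

lemma mask_add_int: "mask_poly A (t + real_of_int k) = mask_poly A t"
proof -
  have "cis (2 * pi * real_of_int a * (t + real_of_int k)) = cis (2 * pi * real_of_int a * t)" for a
  proof -
    have "2 * pi * real_of_int a * (t + real_of_int k)
        = 2 * pi * real_of_int a * t + 2 * pi * real_of_int (a * k)"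
      by (simp add: algebra_simps)
    then show ?thesis
      by (simp add: cis_mult[symmetric] cis_multiple_2pi)
  qed
  then show ?thesis
    by (simp add: mask_poly_def)
qed

lemma mask_zero: "finite A \<Longrightarrow> A \<noteq> {} \<Longrightarrow> mask_poly A 0 = 1"
  by (simp add: mask_poly_def)

text \<open>Expanding the squared modulus over pairs of digits, the sum over \<open>L\<close>
  becomes an inner product of two rows of the unitary matrix, so only the diagonal pairs survive.
  The element 0 of \<open>L\<close> will make the finite spectra nested; a second element will
  supply a zero of the mask.\<close>

lemma admissible_pair_mask_spectrum:
  assumes "admissible_pair N A"
  obtains L :: "int set" where "finite L" "0 \<in> L" "card L \<ge> 2"
    "\<And>x. (\<Sum>l\<in>L. (cmod (mask_poly A ((x + real_of_int l) / real_of_int N)))\<^sup>2) = 1"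
proof -
  define n where "n = card A"
  have n2: "n \<ge> 2" and "finite A" using assms by (auto simp: admissible_pair_def n_def)
  obtain L where L: "finite L" "card L = n"
    and orth: "\<And>a a'. a \<in> A \<Longrightarrow> a' \<in> A \<Longrightarrow>
      (\<Sum>l\<in>L. (complex_of_real (1 / sqrt (real n)) * cis (- 2 * pi * (real_of_int a / real_of_int N) * real_of_int l)) *
         cnj (complex_of_real (1 / sqrt (real n)) * cis (- 2 * pi * (real_of_int a' / real_of_int N) * real_of_int l)))
      = (if a = a' then 1 else 0)"
    using assms unfolding admissible_pair_def Let_def n_def by blast
  \<comment> \<open>The rows enter in the order \<open>a'\<close>, \<open>a\<close> because the
    exponent in the matrix has the sign opposite to that in \<open>mask_poly\<close>.\<close>
  have prod: "(complex_of_real (1 / sqrt (real n)) * cis (- 2 * pi * (real_of_int a' / real_of_int N) * real_of_int l)) *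
         cnj (complex_of_real (1 / sqrt (real n)) * cis (- 2 * pi * (real_of_int a / real_of_int N) * real_of_int l))
      = cis (2 * pi * (real_of_int a - real_of_int a') * real_of_int l / real_of_int N) / of_nat n" for a a' l
  proof -
    have "complex_of_real (1 / sqrt (real n)) * complex_of_real (1 / sqrt (real n)) = 1 / of_nat n"
      by (simp flip: of_real_mult)
    moreover have "cis (- 2 * pi * (real_of_int a' / real_of_int N) * real_of_int l) *
        cnj (cis (- 2 * pi * (real_of_int a / real_of_int N) * real_of_int l))
        = cis (2 * pi * (real_of_int a - real_of_int a') * real_of_int l / real_of_int N)"
      unfolding cis_cnj cis_mult by (rule arg_cong[of _ _ cis]) (simp add: field_simps diff_divide_distrib)
    ultimately show ?thesis
      by (simp add: field_simps)
  qed
  have orth': "(\<Sum>l\<in>L. cis (2 * pi * (real_of_int a - real_of_int a') * real_of_int l / real_of_int N))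
      = (if a = a' then of_nat n else 0)" if "a \<in> A" "a' \<in> A" for a a'
  proof -
    have "(\<Sum>l\<in>L. cis (2 * pi * (real_of_int a - real_of_int a') * real_of_int l / real_of_int N)) / of_nat n
       = (if a = a' then 1 else 0)"
      using orth[OF that(2,1)] unfolding prod by (simp add: sum_divide_distrib)
    then show ?thesis using n2 by (auto split: if_splits simp: field_simps)
  qed
  have parseval: "(\<Sum>l\<in>L. (cmod (mask_poly A ((x + real_of_int l) / real_of_int N)))\<^sup>2) = 1" for x
  proof -
    let ?c = "\<lambda>a a' l. cis (2 * pi * (real_of_int a - real_of_int a') * x / real_of_int N) *
        cis (2 * pi * (real_of_int a - real_of_int a') * real_of_int l / real_of_int N)"
    have sq: "complex_of_real ((cmod (mask_poly A ((x + real_of_int l) / real_of_int N)))\<^sup>2)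
       = (\<Sum>a\<in>A. \<Sum>a'\<in>A. ?c a a' l) / (of_nat n)\<^sup>2" for l
    proof -
      let ?u = "(x + real_of_int l) / real_of_int N"
      have "complex_of_real ((cmod (mask_poly A ?u))\<^sup>2) = mask_poly A ?u * cnj (mask_poly A ?u)"
        by (rule complex_norm_square)
      also have "\<dots> = (\<Sum>a\<in>A. cis (2 * pi * real_of_int a * ?u)) * (\<Sum>a'\<in>A. cis (- (2 * pi * real_of_int a' * ?u))) / (of_nat n)\<^sup>2"
        by (simp add: mask_poly_def n_def cis_cnj power2_eq_square)
      also have "(\<Sum>a\<in>A. cis (2 * pi * real_of_int a * ?u)) * (\<Sum>a'\<in>A. cis (- (2 * pi * real_of_int a' * ?u)))
        = (\<Sum>a\<in>A. \<Sum>a'\<in>A. ?c a a' l)"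
        unfolding sum_product
      proof (intro sum.cong refl)
        fix a a'
        show "cis (2 * pi * real_of_int a * ?u) * cis (- (2 * pi * real_of_int a' * ?u)) = ?c a a' l"
          unfolding cis_mult by (rule arg_cong[of _ _ cis]) (simp add: algebra_simps add_divide_distrib diff_divide_distrib)
      qed
      finally show ?thesis .
    qed
    have "complex_of_real (\<Sum>l\<in>L. (cmod (mask_poly A ((x + real_of_int l) / real_of_int N)))\<^sup>2)
        = (\<Sum>l\<in>L. \<Sum>a\<in>A. \<Sum>a'\<in>A. ?c a a' l) / (of_nat n)\<^sup>2"
      unfolding of_real_sum sq by (simp add: sum_divide_distrib)
    also have "(\<Sum>l\<in>L. \<Sum>a\<in>A. \<Sum>a'\<in>A. ?c a a' l) = (\<Sum>a\<in>A. \<Sum>a'\<in>A. \<Sum>l\<in>L. ?c a a' l)"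
      by (subst sum.swap, rule sum.cong[OF refl], rule sum.swap)
    also have "\<dots> = (\<Sum>a\<in>A. \<Sum>a'\<in>A. if a = a' then of_nat n else 0)"
      by (intro sum.cong refl) (simp add: orth' flip: sum_distrib_left)
    also have "\<dots> = (of_nat n)\<^sup>2"
      using \<open>finite A\<close> by (simp add: n_def power2_eq_square)
    finally have "complex_of_real (\<Sum>l\<in>L. (cmod (mask_poly A ((x + real_of_int l) / real_of_int N)))\<^sup>2) = 1"
      using n2 by simp
    then show ?thesis by (simp only: of_real_eq_1_iff)
  qed
  \<comment> \<open>The identity holds at every \<open>x\<close>, so it survives translating
    \<open>L\<close> until it contains 0.\<close>
  obtain l0 where l0: "l0 \<in> L" using L n2 by fastforce
  show ?thesis
  proof (rule that[of "(\<lambda>l. l - l0) ` L"])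
    show "finite ((\<lambda>l. l - l0) ` L)" "0 \<in> (\<lambda>l. l - l0) ` L" using L l0 by force+
    show "2 \<le> card ((\<lambda>l. l - l0) ` L)" using L n2 by (subst card_image) (auto simp: inj_on_def)
    fix x
    have "(\<Sum>l\<in>(\<lambda>l. l - l0) ` L. (cmod (mask_poly A ((x + real_of_int l) / real_of_int N)))\<^sup>2) = 
       (\<Sum>l\<in>L. (cmod (mask_poly A (((x - real_of_int l0) + real_of_int l) / real_of_int N)))\<^sup>2)"
      by (subst sum.reindex) (auto simp: inj_on_def algebra_simps)
    then show "(\<Sum>l\<in>(\<lambda>l. l - l0) ` L. (cmod (mask_poly A ((x + real_of_int l) / real_of_int N)))\<^sup>2) = 1"
      using parseval by simp
  qed
qed

section \<open>Nested spectra for finitely many factors\<close>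

locale admissible_sequence =
  fixes N :: "nat \<Rightarrow> int" and B :: "nat \<Rightarrow> int set"
  assumes admissible: "\<And>n. admissible_pair (N n) (B n)"
    and N_pos: "\<And>n. N n > 0"
    and remainder_bounded:
      "summable (\<lambda>n. real (card (B n - {0..N n - 1})) / real (card (B n)))"
begin

lemma N_ge_2: "N n \<ge> 2"
  using admissible[of n] N_pos[of n] by (auto simp: admissible_pair_def)

lemma finite_B: "finite (B n)" and B_nonempty: "B n \<noteq> {}"
  using admissible[of n] by (auto simp: admissible_pair_def)

definition P :: "nat \<Rightarrow> int" where "P m = (\<Prod>k<m. N k)"

lemma P_0 [simp]: "P 0 = 1" and P_Suc: "P (Suc m) = P m * N m"
  by (simp_all add: P_def)

lemma P_ge_power: "P m \<ge> 2 ^ m"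
proof (induction m)
  case (Suc m)
  then show ?case
    using N_ge_2[of m] mult_mono[of 2 "N m" "2 ^ m" "P m"] by (simp add: P_Suc mult.commute)
qed simp

lemma P_pos: "P m > 0"
  using P_ge_power[of m] by (smt (verit) zero_less_power)

lemma P_dvd: "m \<le> n \<Longrightarrow> P m dvd P n"
  by (induction n rule: dec_induct) (auto simp: P_Suc)

definition pft :: "nat \<Rightarrow> real \<Rightarrow> complex" where
  "pft m t = (\<Prod>k<m. mask_poly (B k) (t / real_of_int (P (Suc k))))"

lemma pft_0 [simp]: "pft 0 t = 1"
  and pft_Suc: "pft (Suc m) t = pft m t * mask_poly (B m) (t / real_of_int (P (Suc m)))"
  by (simp_all add: pft_def)

lemma pft_zero [simp]: "pft m 0 = 1"
  by (simp add: pft_def mask_zero finite_B B_nonempty)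

text \<open>Factor \<open>i\<close> has period \<open>P (Suc i)\<close>, a divisor of
  \<open>P m\<close>.\<close>

lemma pft_period: "pft m (t + real_of_int (P m * k)) = pft m t"
  unfolding pft_def
proof (rule prod.cong[OF refl])
  fix i assume "i \<in> {..<m}"
  then obtain q where q: "P m = P (Suc i) * q" using P_dvd[of "Suc i" m] by (auto simp: dvd_def)
  have "(t + real_of_int (P m * k)) / real_of_int (P (Suc i)) = t / real_of_int (P (Suc i)) + real_of_int (q * k)"
    using P_pos[of "Suc i"] by (simp add: q field_simps)
  then show "mask_poly (B i) ((t + real_of_int (P m * k)) / real_of_int (P (Suc i))) = mask_poly (B i) (t / real_of_int (P (Suc i)))"
    by (simp only: mask_add_int)
qed

text \<open>The Jorgensen-Pedersen criterion for a spectrum. With \<open>x\<close> ranging over the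
  reals it contains both orthogonality and completeness.\<close>

definition partial_spectrum :: "nat \<Rightarrow> int set \<Rightarrow> bool" where
  "partial_spectrum m S \<longleftrightarrow> finite S \<and> (\<forall>x. (\<Sum>s\<in>S. (cmod (pft m (x + real_of_int s)))\<^sup>2) = 1)"

text \<open>Evaluating the Parseval identity at \<open>- t\<close> leaves no room for the other summands.\<close>

lemma partial_spectrum_orthogonal:
  assumes "partial_spectrum m S" "s \<in> S" "t \<in> S" "s \<noteq> t"
  shows "pft m (real_of_int (s - t)) = 0"
proof -
  have "finite S" using assms by (auto simp: partial_spectrum_def)
  have "1 = (\<Sum>u\<in>S. (cmod (pft m (- real_of_int t + real_of_int u)))\<^sup>2)"
    using assms(1) unfolding partial_spectrum_def by metis
  also have "\<dots> = 1 + (\<Sum>u\<in>S - {t}. (cmod (pft m (- real_of_int t + real_of_int u)))\<^sup>2)"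
    using \<open>finite S\<close> assms(3) by (subst sum.remove[of S t]) auto
  finally have "(\<Sum>u\<in>S - {t}. (cmod (pft m (- real_of_int t + real_of_int u)))\<^sup>2) = 0" by simp
  then have "\<forall>u\<in>S - {t}. (cmod (pft m (- real_of_int t + real_of_int u)))\<^sup>2 = 0"
    using \<open>finite S\<close> by (subst (asm) sum_nonneg_eq_0_iff) auto
  then show ?thesis using assms by (auto simp: algebra_simps)
qed

text \<open>Periodicity preserves every summand. A collision of shifted frequencies would make
  \<open>s - t\<close> a multiple of \<open>P m\<close>, where \<open>pft m\<close> is 1, against
  orthogonality.\<close>

lemma partial_spectrum_shift:
  assumes S: "partial_spectrum m S"
  shows "partial_spectrum m ((\<lambda>s. s + P m * k s) ` S)"
proof -
  have inj: "inj_on (\<lambda>s. s + P m * k s) S"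
  proof (rule inj_onI, rule ccontr)
    fix s t assume st: "s \<in> S" "t \<in> S" "s + P m * k s = t + P m * k t" "s \<noteq> t"
    then have "s - t = P m * (k t - k s)"
      by (simp add: algebra_simps)
    then have "real_of_int (s - t) = 0 + real_of_int (P m * (k t - k s))"
      by simp
    then have "pft m (real_of_int (s - t)) = 1"
      by (simp only: pft_period pft_zero)
    then show False using partial_spectrum_orthogonal[OF S st(1,2,4)] by simp
  qed
  show ?thesis
    unfolding partial_spectrum_def
  proof (intro conjI allI)
    show "finite ((\<lambda>s. s + P m * k s) ` S)" using S by (auto simp: partial_spectrum_def)
    fix x
    have "(\<Sum>s\<in>(\<lambda>s. s + P m * k s) ` S. (cmod (pft m (x + real_of_int s)))\<^sup>2)
      = (\<Sum>s\<in>S. (cmod (pft m ((x + real_of_int s) + real_of_int (P m * k s))))\<^sup>2)"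
      by (subst sum.reindex[OF inj]) (simp add: algebra_simps)
    also have "\<dots> = 1"
      unfolding pft_period using S by (simp add: partial_spectrum_def)
    finally show "(\<Sum>s\<in>(\<lambda>s. s + P m * k s) ` S. (cmod (pft m (x + real_of_int s)))\<^sup>2) = 1" .
  qed
qed

text \<open>The new spectrum is \<open>S + P m * L\<close>: by periodicity the double sum factors,
  and for each \<open>s\<close> the sum over \<open>L\<close> is 1. The element 0 of
  \<open>L\<close> retains \<open>S\<close>.\<close>

lemma partial_spectrum_Suc:
  assumes S: "partial_spectrum m S"
  shows "\<exists>S'. S \<subseteq> S' \<and> partial_spectrum (Suc m) S'"
proof -
  obtain L where L: "finite L" "0 \<in> L"
    and par: "\<And>x. (\<Sum>l\<in>L. (cmod (mask_poly (B m) ((x + real_of_int l) / real_of_int (N m))))\<^sup>2) = 1"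
    using admissible_pair_mask_spectrum[OF admissible] by metis
  let ?g = "\<lambda>(s, l). s + P m * l"
  have "finite S" using S by (simp add: partial_spectrum_def)
  have pft: "pft (Suc m) (x + real_of_int (s + P m * l)) =
      pft m (x + real_of_int s) * mask_poly (B m) (((x + real_of_int s) / real_of_int (P m) + real_of_int l) / real_of_int (N m))" for x s l
  proof -
    have "pft m (x + real_of_int (s + P m * l)) = pft m (x + real_of_int s)"
      using pft_period[of m "x + real_of_int s" l] by (simp add: algebra_simps)
    moreover have "(x + real_of_int (s + P m * l)) / real_of_int (P (Suc m)) = ((x + real_of_int s) / real_of_int (P m) + real_of_int l) / real_of_int (N m)"
      using P_pos[of m] N_pos[of m] by (simp add: P_Suc field_simps)
    ultimately show ?thesis by (simp only: pft_Suc)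
  qed
  have sum1: "(\<Sum>(s, l)\<in>S \<times> L. (cmod (pft (Suc m) (x + real_of_int (s + P m * l))))\<^sup>2) = 1" for x
  proof -
    have "(\<Sum>(s, l)\<in>S \<times> L. (cmod (pft (Suc m) (x + real_of_int (s + P m * l))))\<^sup>2)
       = (\<Sum>s\<in>S. (cmod (pft m (x + real_of_int s)))\<^sup>2 * (\<Sum>l\<in>L. (cmod (mask_poly (B m) (((x + real_of_int s) / real_of_int (P m) + real_of_int l) / real_of_int (N m))))\<^sup>2))"
      unfolding pft norm_mult power_mult_distrib sum_distrib_left by (subst sum.cartesian_product) auto
    also have "\<dots> = 1" unfolding par using S by (simp add: partial_spectrum_def)
    finally show ?thesis .
  qed
  have inj: "inj_on ?g (S \<times> L)"
  proof (rule inj_onI, rule ccontr)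
    fix p q assume pq: "p \<in> S \<times> L" "q \<in> S \<times> L" "?g p = ?g q" "p \<noteq> q"
    \<comment> \<open>At minus the common value, both colliding summands are 1, while the total is
      only 1.\<close>
    let ?x = "- real_of_int (?g p)"
    have "(\<Sum>r\<in>{p, q}. (cmod (pft (Suc m) (?x + real_of_int (?g r))))\<^sup>2)
       \<le> (\<Sum>r\<in>S \<times> L. (cmod (pft (Suc m) (?x + real_of_int (?g r))))\<^sup>2)"
      using pq \<open>finite S\<close> L by (intro sum_mono2) auto
    also have "\<dots> = 1" using sum1[of ?x] by (simp add: case_prod_beta)
    finally show False using pq by simp
  qed
  have "partial_spectrum (Suc m) (?g ` (S \<times> L))"
    unfolding partial_spectrum_def
  proof (intro conjI allI)
    show "finite (?g ` (S \<times> L))" using \<open>finite S\<close> L by simp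
    fix x
    show "(\<Sum>s\<in>?g ` (S \<times> L). (cmod (pft (Suc m) (x + real_of_int s)))\<^sup>2) = 1"
      unfolding sum.reindex[OF inj] using sum1[of x] by (simp add: case_prod_beta o_def)
  qed
  moreover have "S \<subseteq> ?g ` (S \<times> L)" using L(2) by force
  ultimately show ?thesis by blast
qed

lemma partial_spectrum_extend:
  assumes "partial_spectrum m S" "m \<le> n"
  shows "\<exists>S'. S \<subseteq> S' \<and> partial_spectrum n S'"
  using assms(2)
proof (induction n rule: dec_induct)
  case base
  then show ?case using assms(1) by blast
next
  case (step n)
  then show ?case using partial_spectrum_Suc by (meson order_trans)
qed

end

section \<open>The infinite convolution as the law of a random series\<close>

context admissible_sequence
begin

text \<open>One space carries all digits, so that tails with different starting points can be
  compared pointwise.\<close>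

definition Omega :: "(nat \<Rightarrow> int) measure" where
  "Omega = (\<Pi>\<^sub>M i\<in>UNIV. measure_pmf (pmf_of_set (B i)))"

sublocale Om: prob_space Omega
  unfolding Omega_def by (rule prob_space_PiM) (rule measure_pmf.prob_space_axioms)

lemma space_Omega [simp]: "space Omega = UNIV"
  by (simp add: Omega_def space_PiM)

lemma measurable_digit: "(\<lambda>\<omega>. \<omega> i) \<in> Omega \<rightarrow>\<^sub>M count_space UNIV"
  using measurable_component_singleton[of i UNIV "\<lambda>i. measure_pmf (pmf_of_set (B i))"]
  by (simp add: Omega_def)

lemma measurable_digit_fun [measurable]: "(\<lambda>\<omega>. f (\<omega> i)) \<in> borel_measurable Omega"
  by (rule measurable_compose[OF measurable_digit]) simp

lemma distr_digit: "distr Omega (count_space UNIV) (\<lambda>\<omega>. \<omega> i) = measure_pmf (pmf_of_set (B i))"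
proof -
  have "distr Omega (measure_pmf (pmf_of_set (B i))) (\<lambda>\<omega>. \<omega> i) = measure_pmf (pmf_of_set (B i))"
    unfolding Omega_def by (rule distr_PiM_component) (auto intro: measure_pmf.prob_space_axioms)
  moreover have "distr Omega (measure_pmf (pmf_of_set (B i))) (\<lambda>\<omega>. \<omega> i) = distr Omega (count_space UNIV) (\<lambda>\<omega>. \<omega> i)"
    by (rule distr_cong) auto
  ultimately show ?thesis by simp
qed

lemma sets_digit [measurable]: "{\<omega>. \<omega> i \<in> A} \<in> sets Omega"
  using measurable_sets[OF measurable_digit[of i], of A] by (simp add: vimage_def)

lemma prob_digit: "Om.prob {\<omega>. \<omega> i \<in> A} = real (card (B i \<inter> A)) / real (card (B i))"
proof -
  have "Om.prob {\<omega>. \<omega> i \<in> A} = measure (distr Omega (count_space UNIV) (\<lambda>\<omega>. \<omega> i)) A"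
    using measurable_digit by (subst measure_distr) (auto simp: vimage_def)
  also have "\<dots> = real (card (B i \<inter> A)) / real (card (B i))"
    unfolding distr_digit using finite_B B_nonempty by (subst measure_pmf_of_set) auto
  finally show ?thesis .
qed

lemma indep_digits: "Om.indep_vars (\<lambda>_. borel) (\<lambda>k \<omega>. f k (\<omega> (m + k)) :: real) UNIV"
proof -
  let ?M = "\<lambda>i. measure_pmf (pmf_of_set (B i))"
  have "Om.indep_vars (\<lambda>k. ?M (m + k)) (\<lambda>k \<omega>. \<omega> (m + k)) UNIV"
  proof (subst Om.indep_vars_iff_distr_eq_PiM')
    show "(\<lambda>\<omega>. \<omega> (m + k)) \<in> Omega \<rightarrow>\<^sub>M ?M (m + k)" for k using measurable_digit by simp
    have "distr Omega (\<Pi>\<^sub>M k\<in>UNIV. ?M (m + k)) (\<lambda>x. \<lambda>k\<in>UNIV. x (m + k)) = (\<Pi>\<^sub>M k\<in>UNIV. ?M (m + k))"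
      unfolding Omega_def by (rule distr_PiM_reindex) (auto intro: measure_pmf.prob_space_axioms)
    moreover have "distr Omega (?M i) (\<lambda>\<omega>. \<omega> i) = ?M i" for i
      unfolding Omega_def by (rule distr_PiM_component) (auto intro: measure_pmf.prob_space_axioms)
    ultimately show "distr Omega (\<Pi>\<^sub>M k\<in>UNIV. ?M (m + k)) (\<lambda>x. \<lambda>k\<in>UNIV. x (m + k))
        = (\<Pi>\<^sub>M k\<in>UNIV. distr Omega (?M (m + k)) (\<lambda>\<omega>. \<omega> (m + k)))"
      by simp
  qed auto
  then show ?thesis by (rule Om.indep_vars_compose2) auto
qed

section \<open>Tails of the series and their digit bounds\<close>

definition tail_term :: "nat \<Rightarrow> nat \<Rightarrow> (nat \<Rightarrow> int) \<Rightarrow> real" where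
  "tail_term m k \<omega> = real_of_int (\<omega> (m + k)) * (real_of_int (P m) / real_of_int (P (Suc (m + k))))"

text \<open>On \<open>good m\<close> this is a mixed-radix fraction with digits
  \<open>\<omega> m\<close>, \<open>\<omega> (Suc m)\<close>, ... in the bases \<open>N m\<close>,
  \<open>N (Suc m)\<close>, ...; the factor \<open>P m\<close> in the terms rescales it to
  [0,1].\<close>

definition tail :: "nat \<Rightarrow> (nat \<Rightarrow> int) \<Rightarrow> real" where
  "tail m \<omega> = (\<Sum>k. tail_term m k \<omega>)"

definition good :: "nat \<Rightarrow> (nat \<Rightarrow> int) set" where
  "good m = {\<omega>. \<forall>k\<ge>m. \<omega> k \<in> {0..N k - 1}}"

lemma tail_term_measurable [measurable]: "tail_term m k \<in> borel_measurable Omega"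
  unfolding tail_term_def by measurable

lemma tail_measurable [measurable]: "tail m \<in> borel_measurable Omega"
  unfolding tail_def by measurable

lemma good_sets [measurable]: "good m \<in> sets Omega"
proof -
  have "good m = (\<Inter>k. {\<omega>. \<omega> (m + k) \<in> {0..N (m + k) - 1}})"
    by (auto simp: good_def) (metis le_add_diff_inverse)+
  moreover have "UNIV \<in> sets Omega" using sets.top[of Omega] by simp
  ultimately show ?thesis by (simp only:) (intro sets.countable_INT'' sets_digit countableI_type)
qed

text \<open>Borel-Cantelli: the remainder bounded condition says that the probabilities of an
  out-of-range digit are summable.\<close>

lemma AE_good: "AE \<omega> in Omega. \<exists>n. \<omega> \<in> good n"
proof -
  have "AE \<omega> in Omega. eventually (\<lambda>n. \<omega> \<in> space Omega - {\<omega>. \<omega> n \<in> - {0..N n - 1}}) sequentially"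
  proof (rule borel_cantelli_AE1)
    have "B n \<inter> - {0..N n - 1} = B n - {0..N n - 1}" for n by auto
    then show "summable (\<lambda>n. Om.prob {\<omega>. \<omega> n \<in> - {0..N n - 1}})"
      unfolding prob_digit using remainder_bounded by simp
  qed (auto simp: less_top[symmetric] simp del: Compl_iff)
  then show ?thesis
    by eventually_elim (auto simp: good_def eventually_sequentially)
qed

lemma P_ratio_le: "real_of_int (P m) / real_of_int (P (m + k)) \<le> (1/2) ^ k"
proof (induction k)
  case 0
  then show ?case using P_pos[of m] by simp
next
  case (Suc k)
  have "real_of_int (P m) / real_of_int (P (m + Suc k)) = (real_of_int (P m) / real_of_int (P (m + k))) * (1 / real_of_int (N (m + k)))"
    by (simp add: P_Suc)
  also have "\<dots> \<le> (1/2) ^ k * (1/2)"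
    using Suc N_ge_2[of "m + k"] P_pos[of m] P_pos[of "m + k"] by (intro mult_mono) (auto simp: divide_simps)
  finally show ?case by simp
qed

text \<open>The upper bound comes from digits being at most \<open>N (m + k) - 1\<close>; it is
  written as a difference so that it telescopes to a total of at most 1.\<close>

lemma tail_term_bounds:
  assumes "\<omega> (m + k) \<in> {0..N (m + k) - 1}"
  shows "0 \<le> tail_term m k \<omega>"
    "tail_term m k \<omega> \<le> real_of_int (P m) / real_of_int (P (m + k)) - real_of_int (P m) / real_of_int (P (m + Suc k))"
proof -
  show "0 \<le> tail_term m k \<omega>"
    using assms P_pos[of m] P_pos[of "Suc (m + k)"] by (simp add: tail_term_def)
  have "real_of_int (\<omega> (m + k)) \<le> real_of_int (N (m + k) - 1)"
    unfolding of_int_le_iff using assms by simp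
  then have "tail_term m k \<omega> \<le> (real_of_int (N (m + k)) - 1) * (real_of_int (P m) / real_of_int (P (Suc (m + k))))"
    unfolding tail_term_def using assms P_pos[of m] P_pos[of "Suc (m + k)"]
    by (intro mult_right_mono) auto
  also have "\<dots> = real_of_int (P m) / real_of_int (P (m + k)) - real_of_int (P m) / real_of_int (P (m + Suc k))"
    using N_pos[of "m + k"] P_pos[of "m + k"] by (simp add: P_Suc field_simps)
  finally show "tail_term m k \<omega> \<le> real_of_int (P m) / real_of_int (P (m + k)) - real_of_int (P m) / real_of_int (P (m + Suc k))" .
qed

lemma summable_tail_term:
  assumes "\<omega> \<in> good n"
  shows "summable (\<lambda>k. tail_term m k \<omega>)"
proof (rule summable_comparison_test)
  show "\<exists>K. \<forall>k\<ge>K. norm (tail_term m k \<omega>) \<le> (1/2) ^ k"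
  proof (intro exI allI impI)
    fix k assume "k \<ge> n"
    then have b: "\<omega> (m + k) \<in> {0..N (m + k) - 1}" using assms by (auto simp: good_def)
    have "tail_term m k \<omega> \<le> real_of_int (P m) / real_of_int (P (m + k))"
      using tail_term_bounds(2)[of \<omega> m k, OF b] P_pos[of m] P_pos[of "m + Suc k"]
      by (smt (verit) divide_nonneg_nonneg of_int_0_le_iff)
    then show "norm (tail_term m k \<omega>) \<le> (1/2) ^ k"
      using tail_term_bounds(1)[of \<omega> m k, OF b] P_ratio_le[of m k] by simp
  qed
  show "summable (\<lambda>k. (1/2::real) ^ k)" by (rule summable_geometric) simp
qed

lemma AE_summable_tail_term: "AE \<omega> in Omega. summable (\<lambda>k. tail_term m k \<omega>)"
  using AE_good by eventually_elim (auto intro: summable_tail_term)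

lemma tail_bounds:
  assumes "\<omega> \<in> good m"
  shows "0 \<le> tail m \<omega>" "tail m \<omega> \<le> 1"
proof -
  have b: "\<omega> (m + k) \<in> {0..N (m + k) - 1}" for k using assms by (auto simp: good_def)
  show "0 \<le> tail m \<omega>"
    unfolding tail_def by (intro suminf_nonneg summable_tail_term[OF assms] tail_term_bounds b)
  have "(\<Sum>k<n. tail_term m k \<omega>) \<le> 1 - real_of_int (P m) / real_of_int (P (m + n))" for n
  proof (induction n)
    case 0
    then show ?case using P_pos[of m] by simp
  next
    case (Suc n)
    then show ?case using tail_term_bounds(2)[of \<omega> m n, OF b] by simp
  qed
  moreover have "0 \<le> real_of_int (P m) / real_of_int (P (m + n))" for n
    using P_pos[of m] P_pos[of "m + n"] by simp
  ultimately have "(\<Sum>k<n. tail_term m k \<omega>) \<le> 1" for n by (smt (verit))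
  then show "tail m \<omega> \<le> 1"
    unfolding tail_def by (intro suminf_le_const summable_tail_term[OF assms])
qed

text \<open>Splitting off the leading digit. The index \<open>n\<close> is unrelated to
  \<open>m\<close>, since \<open>good n\<close> serves only for convergence.\<close>

lemma tail_Suc:
  assumes "\<omega> \<in> good n"
  shows "tail m \<omega> = (real_of_int (\<omega> m) + tail (Suc m) \<omega>) / real_of_int (N m)"
proof -
  have t: "tail_term m (Suc k) \<omega> = tail_term (Suc m) k \<omega> / real_of_int (N m)" for k
    using N_pos[of m] by (simp add: tail_term_def P_Suc)
  have t0: "tail_term m 0 \<omega> = real_of_int (\<omega> m) / real_of_int (N m)"
    using P_pos[of m] by (simp add: tail_term_def P_Suc)
  have "tail m \<omega> = (\<Sum>k. tail_term m (Suc k) \<omega>) + tail_term m 0 \<omega>"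
    unfolding tail_def using suminf_split_head[OF summable_tail_term[OF assms, of m]] by simp
  also have "(\<Sum>k. tail_term m (Suc k) \<omega>) = tail (Suc m) \<omega> / real_of_int (N m)"
    unfolding t tail_def by (rule suminf_divide[OF summable_tail_term[OF assms]])
  finally show ?thesis by (simp add: t0 add_divide_distrib)
qed

lemma good_mono: "m \<le> n \<Longrightarrow> good m \<subseteq> good n"
  by (auto simp: good_def)

lemma prob_bad_tendsto_0: "(\<lambda>m. Om.prob (- good m)) \<longlonglongrightarrow> 0"
proof -
  have sets: "- good m \<in> sets Omega" for m
    using sets.compl_sets[OF good_sets[of m]] by (simp add: Compl_eq_Diff_UNIV)
  have "(\<lambda>m. Om.prob (- good m)) \<longlonglongrightarrow> Om.prob (\<Inter>m. - good m)"
    using sets good_mono by (intro Om.finite_Lim_measure_decseq) (auto simp: decseq_def)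
  moreover have "Om.prob (\<Inter>m. - good m) = 0"
  proof (rule Om.prob_eq_0[THEN iffD2])
    show "(\<Inter>m. - good m) \<in> Om.events" using sets by (auto intro!: sets.countable_INT'')
    show "AE \<omega> in Omega. \<omega> \<notin> (\<Inter>m. - good m)" using AE_good by eventually_elim auto
  qed
  ultimately show ?thesis by simp
qed

section \<open>Fourier transforms of the tail laws\<close>

definition nu :: "nat \<Rightarrow> real measure" where "nu m = distr Omega borel (tail m)"

lemma real_distribution_nu: "real_distribution (nu m)"
  unfolding nu_def by (rule Om.real_distribution_distr) measurable

lemma ft_digit:
  "ft (distr Omega borel (tail_term m k)) t
    = mask_poly (B (m + k)) (t * (real_of_int (P m) / real_of_int (P (Suc (m + k)))))"
proof -
  let ?r = "real_of_int (P m) / real_of_int (P (Suc (m + k)))"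
  let ?f = "\<lambda>b. cis (2 * pi * t * (real_of_int b * ?r))"
  have "ft (distr Omega borel (tail_term m k)) t = (CLINT \<omega>|Omega. ?f (\<omega> (m + k)))"
    unfolding ft_def by (subst integral_distr) (auto simp: tail_term_def)
  also have "\<dots> = (CLINT b|distr Omega (count_space UNIV) (\<lambda>\<omega>. \<omega> (m + k)). ?f b)"
    using measurable_digit by (subst integral_distr) auto
  also have "\<dots> = (\<Sum>b\<in>B (m + k). pmf (pmf_of_set (B (m + k))) b *\<^sub>R ?f b)"
    unfolding distr_digit using finite_B B_nonempty by (intro integral_measure_pmf) auto
  also have "\<dots> = (\<Sum>b\<in>B (m + k). cis (2 * pi * real_of_int b * (t * ?r)) / of_nat (card (B (m + k))))"
    using finite_B B_nonempty
    by (intro sum.cong refl) (simp add: pmf_of_set scaleR_conv_of_real mult_ac)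
  finally show ?thesis by (simp add: mask_poly_def sum_divide_distrib)
qed

lemma indep_tail_terms: "Om.indep_vars (\<lambda>_. borel) (\<lambda>k. tail_term m k) A"
  unfolding tail_term_def[abs_def] by (rule Om.indep_vars_subset[OF indep_digits]) simp

lemma ft_partial_tail:
  "ft (distr Omega borel (\<lambda>\<omega>. \<Sum>k<n. tail_term m k \<omega>)) t
    = (\<Prod>k<n. mask_poly (B (m + k)) (t * (real_of_int (P m) / real_of_int (P (Suc (m + k))))))"
  unfolding ft_eq_char Om.char_distr_sum[OF indep_tail_terms]
  using ft_digit by (simp add: ft_eq_char)

lemma ft_nu_limit:
  "(\<lambda>n. \<Prod>k<n. mask_poly (B (m + k)) (t * (real_of_int (P m) / real_of_int (P (Suc (m + k))))))
    \<longlonglongrightarrow> ft (nu m) t"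
proof -
  have "(\<lambda>n. CLINT \<omega>|Omega. cis (2 * pi * t * (\<Sum>k<n. tail_term m k \<omega>)))
      \<longlonglongrightarrow> (CLINT \<omega>|Omega. cis (2 * pi * t * tail m \<omega>))"
  proof (rule integral_dominated_convergence[where w = "\<lambda>_. 1"])
    show "AE \<omega> in Omega. (\<lambda>n. cis (2 * pi * t * (\<Sum>k<n. tail_term m k \<omega>))) \<longlonglongrightarrow> cis (2 * pi * t * tail m \<omega>)"
      using AE_summable_tail_term[of m]
    proof eventually_elim
      case (elim \<omega>)
      then have "(\<lambda>n. \<Sum>k<n. tail_term m k \<omega>) \<longlonglongrightarrow> tail m \<omega>"
        unfolding tail_def by (rule summable_LIMSEQ)
      then show ?case by (intro tendsto_intros)
    qed
  qed auto
  then show ?thesis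
    unfolding ft_partial_tail[symmetric] by (simp add: ft_def nu_def integral_distr)
qed

text \<open>Both sides are limits of the same infinite product, once with its first factor split
  off; this takes the place of independence between digit \<open>m\<close> and the later
  tail.\<close>

lemma ft_nu_Suc:
  "ft (nu m) t = mask_poly (B m) (t / real_of_int (N m)) * ft (nu (Suc m)) (t / real_of_int (N m))"
proof (rule LIMSEQ_unique)
  let ?a = "\<lambda>k. mask_poly (B (m + k)) (t * (real_of_int (P m) / real_of_int (P (Suc (m + k)))))"
  show "(\<lambda>n. \<Prod>k<Suc n. ?a k) \<longlonglongrightarrow> ft (nu m) t"
    using ft_nu_limit[of m t] by (rule LIMSEQ_Suc)
  have a0: "?a 0 = mask_poly (B m) (t / real_of_int (N m))"
    using P_pos[of m] by (simp add: P_Suc)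
  have aS: "?a (Suc k) = mask_poly (B (Suc m + k)) (t / real_of_int (N m) * (real_of_int (P (Suc m)) / real_of_int (P (Suc (Suc m + k)))))" for k
    using N_pos[of m] by (simp add: P_Suc)
  show "(\<lambda>n. \<Prod>k<Suc n. ?a k) \<longlonglongrightarrow> mask_poly (B m) (t / real_of_int (N m)) * ft (nu (Suc m)) (t / real_of_int (N m))"
    unfolding prod.lessThan_Suc_shift a0 aS by (intro tendsto_intros ft_nu_limit)
qed

lemma ft_nu_0: "ft (nu 0) t = pft m t * ft (nu m) (t / real_of_int (P m))"
proof (induction m)
  case (Suc m)
  show ?case
    unfolding Suc pft_Suc ft_nu_Suc[of m] by (simp add: P_Suc)
qed simp

lemma pft_tendsto: "(\<lambda>m. pft m t) \<longlonglongrightarrow> ft (nu 0) t"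
  using ft_nu_limit[of 0 t] by (simp add: pft_def)

section \<open>Identification of the weak limit\<close>

lemma distr_tail_term_0:
  "distr Omega borel (tail_term 0 k) = delta_set ((\<lambda>b. real_of_int b / real_of_int (P (Suc k))) ` B k)"
proof -
  let ?g = "\<lambda>b. real_of_int b / real_of_int (P (Suc k))"
  have inj: "inj_on ?g (B k)" using P_pos[of "Suc k"] by (auto simp: inj_on_def)
  have "delta_set (?g ` B k) = distr (measure_pmf (map_pmf ?g (pmf_of_set (B k)))) borel (\<lambda>x. x)"
    unfolding delta_set_def using inj finite_B B_nonempty by (subst map_pmf_of_set_inj) auto
  also have "\<dots> = distr (measure_pmf (pmf_of_set (B k))) borel ?g"
    unfolding map_pmf_rep_eq by (subst distr_distr) (auto simp: o_def)
  also have "\<dots> = distr Omega borel (\<lambda>\<omega>. ?g (\<omega> k))"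
    unfolding distr_digit[symmetric] using measurable_digit[of k] by (subst distr_distr) (auto simp: o_def)
  also have "\<dots> = distr Omega borel (tail_term 0 k)"
    by (simp add: tail_term_def[abs_def])
  finally show ?thesis by simp
qed

lemma conv_partial_eq_distr:
  "conv_partial N B n = distr Omega borel (\<lambda>\<omega>. \<Sum>k<Suc n. tail_term 0 k \<omega>)"
proof (induction n)
  case 0
  show ?case using distr_tail_term_0[of 0] by (simp add: P_Suc)
next
  case (Suc n)
  have PS: "(\<Prod>j\<le>Suc n. N j) = P (Suc (Suc n))"
    unfolding P_def lessThan_Suc_atMost ..
  have "distr Omega borel (\<lambda>\<omega>. \<Sum>k<Suc (Suc n). tail_term 0 k \<omega>)
      = distr Omega borel (\<lambda>\<omega>. tail_term 0 (Suc n) \<omega> + (\<Sum>k<Suc n. tail_term 0 k \<omega>))"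
    by (simp add: add.commute)
  also have "\<dots> = convolution (distr Omega borel (tail_term 0 (Suc n))) (distr Omega borel (\<lambda>\<omega>. \<Sum>k<Suc n. tail_term 0 k \<omega>))"
  proof (rule Om.sum_indep_random_variable)
    show "Om.indep_var borel (tail_term 0 (Suc n)) borel (\<lambda>\<omega>. \<Sum>k<Suc n. tail_term 0 k \<omega>)"
      by (rule Om.indep_vars_sum) (auto intro: indep_tail_terms)
  qed measurable
  also have "\<dots> = convolution (distr Omega borel (\<lambda>\<omega>. \<Sum>k<Suc n. tail_term 0 k \<omega>)) (distr Omega borel (tail_term 0 (Suc n)))"
    by (rule convolution_commutative) (auto intro!: Om.finite_measure_distr)
  also have "\<dots> = conv_partial N B (Suc n)"
    by (simp only: conv_partial.simps Suc.IH distr_tail_term_0 PS)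
  finally show ?case by simp
qed

text \<open>The partial convolutions are laws of partial sums of an almost surely convergent series,
  so dominated convergence applies.\<close>

lemma weak_limit_conv_partial: "weak_limit (conv_partial N B) (nu 0)"
  unfolding weak_limit_def
proof (intro allI impI, elim conjE)
  fix f :: "real \<Rightarrow> real" assume f: "continuous_on UNIV f" "bounded (range f)"
  then have [measurable]: "f \<in> borel_measurable borel" by (intro borel_measurable_continuous_onI)
  from f obtain K where K: "\<And>x. norm (f x) \<le> K" unfolding bounded_iff by auto
  have "(\<lambda>n. LINT \<omega>|Omega. f (\<Sum>k<Suc n. tail_term 0 k \<omega>)) \<longlonglongrightarrow> (LINT \<omega>|Omega. f (tail 0 \<omega>))"
  proof (rule integral_dominated_convergence[where w = "\<lambda>_. K"])
    show "AE \<omega> in Omega. (\<lambda>n. f (\<Sum>k<Suc n. tail_term 0 k \<omega>)) \<longlonglongrightarrow> f (tail 0 \<omega>)"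
      using AE_summable_tail_term[of 0]
    proof eventually_elim
      case (elim \<omega>)
      then have "(\<lambda>n. \<Sum>k<Suc n. tail_term 0 k \<omega>) \<longlonglongrightarrow> tail 0 \<omega>"
        unfolding tail_def by (intro LIMSEQ_Suc summable_LIMSEQ)
      then show ?case using f(1) by (intro isCont_tendsto_compose[where g = f]) (auto simp: continuous_on_eq_continuous_at)
    qed
  qed (use K in auto)
  then show "(\<lambda>n. integral\<^sup>L (conv_partial N B n) f) \<longlonglongrightarrow> integral\<^sup>L (nu 0) f"
    unfolding conv_partial_eq_distr nu_def by (simp add: integral_distr del: sum.lessThan_Suc)
qed

text \<open>Clamping to \<open>[0,1]\<close> changes the tail only off \<open>good m\<close>, hence changes its Fourier
  transform uniformly little; the clamped laws are trivially tight and have Lipschitz transforms.\<close>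

definition clamped :: "nat \<Rightarrow> (nat \<Rightarrow> int) \<Rightarrow> real" where
  "clamped m \<omega> = max 0 (min 1 (tail m \<omega>))"

definition cnu :: "nat \<Rightarrow> real measure" where "cnu m = distr Omega borel (clamped m)"

lemma clamped_measurable [measurable]: "clamped m \<in> borel_measurable Omega"
  unfolding clamped_def by measurable

lemma real_distribution_cnu: "real_distribution (cnu m)"
  unfolding cnu_def by (rule Om.real_distribution_distr) measurable

lemma clamped_range: "0 \<le> clamped m \<omega>" "clamped m \<omega> \<le> 1"
  by (auto simp: clamped_def)

lemma clamped_good: "\<omega> \<in> good m \<Longrightarrow> clamped m \<omega> = tail m \<omega>"
  using tail_bounds by (auto simp: clamped_def)

lemma norm_ft_nu_minus_cnu: "cmod (ft (nu m) t - ft (cnu m) t) \<le> 2 * Om.prob (- good m)"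
proof -
  have sets [measurable]: "- good m \<in> sets Omega"
    using sets.compl_sets[OF good_sets[of m]] by (simp add: Compl_eq_Diff_UNIV)
  have int: "integrable Omega (\<lambda>\<omega>. cis (2 * pi * t * h \<omega>))" if [measurable]: "h \<in> borel_measurable Omega" for h
    by (rule Om.integrable_const_bound[of _ 1]) auto
  have "cmod (ft (nu m) t - ft (cnu m) t) = cmod (CLINT \<omega>|Omega. cis (2 * pi * t * tail m \<omega>) - cis (2 * pi * t * clamped m \<omega>))"
    unfolding ft_def nu_def cnu_def by (simp add: integral_distr int)
  also have "\<dots> \<le> (LINT \<omega>|Omega. cmod (cis (2 * pi * t * tail m \<omega>) - cis (2 * pi * t * clamped m \<omega>)))"
    by (rule integral_norm_bound)
  also have "\<dots> \<le> (LINT \<omega>|Omega. 2 * indicator (- good m) \<omega>)"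
  proof (rule integral_mono)
    show "cmod (cis (2 * pi * t * tail m \<omega>) - cis (2 * pi * t * clamped m \<omega>)) \<le> 2 * indicator (- good m) \<omega>" for \<omega>
      using clamped_good[of \<omega> m] norm_triangle_ineq4[of "cis (2 * pi * t * tail m \<omega>)" "cis (2 * pi * t * clamped m \<omega>)"]
      by (auto split: split_indicator)
  qed (auto intro!: integrable_norm Bochner_Integration.integrable_diff int simp: less_top[symmetric])
  also have "\<dots> = 2 * Om.prob (- good m)" by (simp add: less_top[symmetric])
  finally show ?thesis .
qed

lemma ft_cnu_lipschitz: "cmod (ft (cnu m) s - ft (cnu m) t) \<le> 2 * pi * \<bar>s - t\<bar>"
proof -
  have int: "integrable Omega (\<lambda>\<omega>. cis (2 * pi * t * clamped m \<omega>))" for t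
    by (rule Om.integrable_const_bound[of _ 1]) auto
  have "cmod (ft (cnu m) s - ft (cnu m) t) = cmod (CLINT \<omega>|Omega. cis (2 * pi * s * clamped m \<omega>) - cis (2 * pi * t * clamped m \<omega>))"
    unfolding ft_def cnu_def by (simp add: integral_distr int)
  also have "\<dots> \<le> (LINT \<omega>|Omega. cmod (cis (2 * pi * s * clamped m \<omega>) - cis (2 * pi * t * clamped m \<omega>)))"
    by (rule integral_norm_bound)
  also have "\<dots> \<le> (LINT \<omega>|Omega. 2 * pi * \<bar>s - t\<bar>)"
  proof (rule integral_mono)
    fix \<omega>
    let ?c = "clamped m \<omega>"
    have "cis (2 * pi * s * ?c) - cis (2 * pi * t * ?c) = cis (2 * pi * t * ?c) * (cis (2 * pi * (s - t) * ?c) - 1)"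
      unfolding right_diff_distrib cis_mult by (simp add: algebra_simps)
    then have "cmod (cis (2 * pi * s * ?c) - cis (2 * pi * t * ?c)) = cmod (cis (2 * pi * (s - t) * ?c) - 1)"
      by (simp add: norm_mult)
    also have "\<dots> \<le> \<bar>2 * pi * (s - t) * ?c\<bar>"
      using iexp_approx1[of "2 * pi * (s - t) * ?c" 0] by (simp add: cis_conv_exp)
    also have "\<dots> \<le> 2 * pi * \<bar>s - t\<bar>"
      using clamped_range[of m \<omega>] by (auto simp: abs_mult intro: mult_left_le)
    finally show "cmod (cis (2 * pi * s * ?c) - cis (2 * pi * t * ?c)) \<le> 2 * pi * \<bar>s - t\<bar>" .
  qed (auto intro!: integrable_norm Bochner_Integration.integrable_diff int)
  also have "\<dots> = 2 * pi * \<bar>s - t\<bar>" by (simp add: Om.prob_space[simplified])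
  finally show ?thesis .
qed

end

section \<open>Equi-positivity of the tails\<close>

context admissible_sequence
begin

text \<open>At \<open>x = 0\<close> the summand for 0 is already 1, so any other element of
  \<open>L\<close> gives a zero of the mask, and periodicity reduces it modulo \<open>N m\<close>.
  The range below \<open>N m\<close> leaves finitely many candidates while \<open>N m\<close> is
  bounded.\<close>

lemma ft_nu_zero_int: "\<exists>l::int. 0 < l \<and> l < N m \<and> ft (nu m) (real_of_int l) = 0"
proof -
  obtain L where L: "finite L" "0 \<in> L" "card L \<ge> 2"
    and par: "\<And>x. (\<Sum>l\<in>L. (cmod (mask_poly (B m) ((x + real_of_int l) / real_of_int (N m))))\<^sup>2) = 1"
    using admissible_pair_mask_spectrum[OF admissible] by metis
  have "L \<noteq> {0}" using L(3) by auto
  then obtain l where l: "l \<in> L" "l \<noteq> 0" using L(2) by auto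
  have "(\<Sum>k\<in>{0, l}. (cmod (mask_poly (B m) ((0 + real_of_int k) / real_of_int (N m))))\<^sup>2) \<le> 1"
    unfolding par[of 0, symmetric] using L l by (intro sum_mono2) auto
  then have m0: "mask_poly (B m) (real_of_int l / real_of_int (N m)) = 0"
    using l(2) mask_zero[OF finite_B B_nonempty, of m] by simp
  define r where "r = l mod N m"
  have "l = r + N m * (l div N m)" by (simp add: r_def)
  then have "real_of_int l = real_of_int r + real_of_int (N m) * real_of_int (l div N m)"
    by (metis of_int_add of_int_mult)
  then have "real_of_int l / real_of_int (N m) = real_of_int r / real_of_int (N m) + real_of_int (l div N m)"
    using N_pos[of m] by (simp add: field_simps)
  then have mr: "mask_poly (B m) (real_of_int r / real_of_int (N m)) = 0"
    using m0 by (simp add: mask_add_int)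
  have "r \<noteq> 0" using mr mask_zero[OF finite_B B_nonempty, of m] by auto
  moreover have "0 \<le> r" "r < N m" using N_pos[of m] by (auto simp: r_def)
  moreover have "ft (nu m) (real_of_int r) = 0" using mr by (simp add: ft_nu_Suc[of m])
  ultimately show ?thesis by (intro exI[of _ r]) auto
qed

lemma integral_cnu:
  fixes G :: "real \<Rightarrow> 'b::{banach, second_countable_topology}"
  shows "G \<in> borel_measurable borel \<Longrightarrow> integral\<^sup>L (cnu m) G = (LINT \<omega>|Omega. G (clamped m \<omega>))"
  unfolding cnu_def by (subst integral_distr) auto

text \<open>This bound and the next translate between digit events and continuous test functions,
  whose integrals weak convergence controls.\<close>

lemma integral_clamped_le_prob:
  assumes [measurable]: "G \<in> borel_measurable borel" "E \<in> sets Omega"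
    and G: "\<And>t. 0 \<le> G t" "\<And>t. G t \<le> 1" and z: "\<And>\<omega>. \<omega> \<notin> E \<Longrightarrow> G (clamped m \<omega>) = 0"
  shows "(LINT \<omega>|Omega. G (clamped m \<omega>)) \<le> Om.prob E"
proof -
  have "(LINT \<omega>|Omega. G (clamped m \<omega>)) \<le> (LINT \<omega>|Omega. indicator E \<omega>)"
  proof (rule integral_mono)
    show "integrable Omega (\<lambda>\<omega>. G (clamped m \<omega>))"
      by (rule Om.integrable_const_bound[of _ 1]) (auto simp: G)
    show "G (clamped m \<omega>) \<le> indicator E \<omega>" for \<omega> using z[of \<omega>] G by (auto split: split_indicator)
  qed (auto simp: less_top[symmetric])
  also have "\<dots> = Om.prob E" by simp
  finally show ?thesis .
qed

lemma prob_le_integral_clamped: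
  assumes [measurable]: "G \<in> borel_measurable borel" "E \<in> sets Omega"
    and G: "\<And>t. 0 \<le> G t" "\<And>t. G t \<le> 1" and z: "\<And>\<omega>. \<omega> \<in> E \<Longrightarrow> G (clamped m \<omega>) = 1"
  shows "Om.prob E \<le> (LINT \<omega>|Omega. G (clamped m \<omega>))"
proof -
  have "(LINT \<omega>|Omega. indicator E \<omega>) \<le> (LINT \<omega>|Omega. G (clamped m \<omega>))"
  proof (rule integral_mono)
    show "integrable Omega (\<lambda>\<omega>. G (clamped m \<omega>))"
      by (rule Om.integrable_const_bound[of _ 1]) (auto simp: G)
    show "indicator E \<omega> \<le> G (clamped m \<omega>)" for \<omega> using z[of \<omega>] G by (auto split: split_indicator)
  qed (auto simp: less_top[symmetric])
  then show ?thesis by simp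
qed

text \<open>All clamped laws live on one compact interval, hence are tight. Integrating the capped
  distance to [0,1] shows that the limit stays there.\<close>

lemma cnu_convergent_subseq:
  fixes mm :: "nat \<Rightarrow> nat"
  obtains r M where "strict_mono r" "real_distribution M" "weak_conv_m (\<lambda>n. cnu (mm (r n))) M"
    "AE t in M. 0 \<le> t \<and> t \<le> 1"
proof -
  have full: "measure (cnu m) {- 1<..1} = 1" for m
  proof -
    have "measure (cnu m) {- 1<..1} = Om.prob (space Omega)"
      unfolding cnu_def using clamped_range[of m]
      by (subst measure_distr) (auto intro!: arg_cong[where f = Om.prob] simp: less_le_trans[of "-1" 0])
    then show ?thesis by (simp only: Om.prob_space)
  qed
  have "tight (\<lambda>n. cnu (mm n))"
    unfolding tight_def
  proof (intro conjI allI impI real_distribution_cnu)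
    fix e :: real assume "0 < e"
    then show "\<exists>a b. a < b \<and> (\<forall>n. 1 - e < measure (cnu (mm n)) {a<..b})"
      \<comment> \<open>\<open>{a<..b}\<close> is open on the left, so the left end has to lie below
        0.\<close>
      by (intro exI[of _ "- 1"] exI[of _ 1]) (simp add: full)
  qed
  then obtain r M where r: "strict_mono r" "real_distribution M" "weak_conv_m ((\<lambda>n. cnu (mm n)) \<circ> id \<circ> r) M"
    using tight_imp_convergent_subsubsequence[of "\<lambda>n. cnu (mm n)" id] by (auto simp: strict_mono_def)
  then have wc: "weak_conv_m (\<lambda>n. cnu (mm (r n))) M" by (simp add: o_def)
  interpret M: real_distribution M by fact
  define G where "G t = min 1 (max 0 (max (- t) (t - 1)))" for t :: real
  have Gc: "continuous_on UNIV G" unfolding G_def by (intro continuous_intros)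
  then have [measurable]: "G \<in> borel_measurable borel" by (rule borel_measurable_continuous_onI)
  have "(\<lambda>n. integral\<^sup>L (cnu (mm (r n))) G) \<longlonglongrightarrow> integral\<^sup>L M G"
  proof (rule weak_conv_imp_integral_bdd_continuous_conv[OF real_distribution_cnu r(2) wc])
    show "isCont G x" for x using Gc by (simp add: continuous_on_eq_continuous_at)
    show "norm (G x) \<le> 1" for x by (simp add: G_def)
  qed
  moreover have "integral\<^sup>L (cnu m) G = 0" for m
  proof -
    have "G (clamped m \<omega>) = 0" for \<omega> using clamped_range[of m \<omega>] by (simp add: G_def)
    then show ?thesis by (simp add: integral_cnu)
  qed
  ultimately have "integral\<^sup>L M G = 0" by (simp add: LIMSEQ_const_iff)
  moreover have "integrable M G"
    by (rule M.integrable_const_bound[of _ 1]) (auto simp: G_def)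
  ultimately have "AE t in M. G t = 0"
    using integral_nonneg_eq_0_iff_AE[of M G] by (auto simp: G_def)
  then have "AE t in M. 0 \<le> t \<and> t \<le> 1"
    by eventually_elim (auto simp: G_def min_def max_def split: if_splits)
  then show ?thesis using that r wc by blast
qed

lemma equi_positive:
  fixes s :: "nat \<Rightarrow> nat"
  assumes s: "strict_mono s" and pcc: "pcc (\<lambda>k. N (s k)) (\<lambda>k. B (s k))"
  shows "\<exists>e>0. \<exists>K. \<forall>k\<ge>K. \<forall>x. \<exists>j::int. cmod (ft (cnu (s k)) (x + real_of_int j)) \<ge> e"
proof (rule ccontr)
  assume "\<not> ?thesis"
  then have "\<forall>e>0. \<forall>K. \<exists>k\<ge>K. \<exists>x. \<forall>j::int. cmod (ft (cnu (s k)) (x + real_of_int j)) < e"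
    by (auto simp: not_le)
  then have "\<forall>n. \<exists>k x. k \<ge> n \<and> (\<forall>j::int. cmod (ft (cnu (s k)) (x + real_of_int j)) < 1 / real (Suc n))"
    by (metis of_nat_0_less_iff zero_less_Suc zero_less_divide_1_iff)
  \<comment> \<open>\<open>kk\<close> may fail to be monotone; \<open>kk n \<ge> n\<close> already
    makes it tend to infinity.\<close>
  then obtain kk x0 where kk: "\<And>n. kk n \<ge> n"
    and x0: "\<And>n j. cmod (ft (cnu (s (kk n))) (x0 n + real_of_int j)) < 1 / real (Suc n)" by metis
  \<comment> \<open>Smallness holds on a whole coset of the integers, so its representative can be
    taken in the compact interval [0,1].\<close>
  define xx where "xx n = frac (x0 n)" for n
  have xx: "cmod (ft (cnu (s (kk n))) (xx n + real_of_int j)) < 1 / real (Suc n)" for n j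
    using x0[of n "j - \<lfloor>x0 n\<rfloor>"] by (simp add: xx_def frac_def algebra_simps)
  have "\<forall>n. xx n \<in> {0..1}" by (simp add: xx_def frac_ge_0 less_imp_le[OF frac_lt_1])
  then obtain u r1 where u: "u \<in> {0..1}" and r1: "strict_mono r1" "(xx \<circ> r1) \<longlonglongrightarrow> u"
    using compact_Icc[of "0::real" 1, unfolded compact_eq_seq_compact_metric seq_compact_def] by blast
  obtain r2 M where r2: "strict_mono r2" and M: "real_distribution M"
    and wc: "weak_conv_m (\<lambda>n. cnu (s (kk (r1 (r2 n))))) M"
    and supp: "AE t in M. 0 \<le> t \<and> t \<le> 1"
    using cnu_convergent_subseq[of "\<lambda>n. s (kk (r1 n))"] by blast
  interpret M: real_distribution M by fact
  define q where "q n = r1 (r2 n)" for n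
  define k where "k n = kk (q n)" for n
  define m where "m n = s (k n)" for n
  have q_ge: "q n \<ge> n" for n
    using seq_suble[OF r1(1), of "r2 n"] seq_suble[OF r2, of n] by (simp add: q_def)
  have k_ge: "k n \<ge> n" for n using kk[of "q n"] q_ge[of n] by (simp add: k_def)
  have m_ge: "m n \<ge> n" for n using seq_suble[OF s, of "k n"] k_ge[of n] by (simp add: m_def)
  have k_top: "filterlim k at_top sequentially"
    by (rule filterlim_at_top_mono[OF filterlim_ident]) (simp add: k_ge)
  have m_top: "filterlim m at_top sequentially"
    by (rule filterlim_at_top_mono[OF filterlim_ident]) (simp add: m_ge)
  have wcm: "weak_conv_m (\<lambda>n. cnu (m n)) M" using wc by (simp add: m_def k_def q_def)
  have bad: "(\<lambda>n. Om.prob (- good (m n))) \<longlonglongrightarrow> 0"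
    using prob_bad_tendsto_0 m_top by (rule filterlim_compose)
  have xq: "(\<lambda>n. xx (q n)) \<longlonglongrightarrow> u"
    using LIMSEQ_subseq_LIMSEQ[OF r1(2) r2] by (simp add: o_def q_def)
  have ftM: "(\<lambda>n. ft (cnu (m n)) t) \<longlonglongrightarrow> ft M t" for t
    unfolding ft_eq_char by (rule levy_continuity1[OF real_distribution_cnu M wcm])
  \<comment> \<open>The Lipschitz constant is the same for all \<open>n\<close>, so the moving
    frequencies \<open>xx (q n)\<close> may be replaced by their limit \<open>u\<close>.\<close>
  have zero: "ft M (u + real_of_int j) = 0" for j
  proof -
    have "(\<lambda>n. ft (cnu (m n)) (u + real_of_int j)) \<longlonglongrightarrow> 0"
    proof (rule Lim_null_comparison)
      show "\<forall>\<^sub>F n in sequentially. norm (ft (cnu (m n)) (u + real_of_int j)) \<le> 1 / real (Suc n) + 2 * pi * \<bar>xx (q n) - u\<bar>"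
      proof (intro always_eventually allI)
        fix n
        have "norm (ft (cnu (m n)) (u + real_of_int j)) \<le> cmod (ft (cnu (m n)) (xx (q n) + real_of_int j))
            + cmod (ft (cnu (m n)) (u + real_of_int j) - ft (cnu (m n)) (xx (q n) + real_of_int j))"
          by (rule norm_triangle_sub)
        moreover have "cmod (ft (cnu (m n)) (xx (q n) + real_of_int j)) \<le> 1 / real (Suc n)"
        proof -
          have "1 / real (Suc (q n)) \<le> 1 / real (Suc n)" using q_ge[of n] by (simp add: frac_le)
          then show ?thesis using xx[of "q n" j] by (simp add: m_def k_def)
        qed
        moreover have "cmod (ft (cnu (m n)) (u + real_of_int j) - ft (cnu (m n)) (xx (q n) + real_of_int j)) \<le> 2 * pi * \<bar>xx (q n) - u\<bar>"
          using ft_cnu_lipschitz[of "m n" "u + real_of_int j" "xx (q n) + real_of_int j"]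
          by (simp add: abs_minus_commute)
        ultimately show "norm (ft (cnu (m n)) (u + real_of_int j)) \<le> 1 / real (Suc n) + 2 * pi * \<bar>xx (q n) - u\<bar>"
          by linarith
      qed
      have "(\<lambda>n. 1 / real (Suc n) + 2 * pi * \<bar>xx (q n) - u\<bar>) \<longlonglongrightarrow> 0 + 2 * pi * \<bar>u - u\<bar>"
        using LIMSEQ_inverse_real_of_nat by (intro tendsto_intros xq) (simp add: inverse_eq_divide)
      then show "(\<lambda>n. 1 / real (Suc n) + 2 * pi * \<bar>xx (q n) - u\<bar>) \<longlonglongrightarrow> 0" by simp
    qed
    then show ?thesis using ftM LIMSEQ_unique by blast
  qed
  have lim: "(\<lambda>n. LINT \<omega>|Omega. G (clamped (m n) \<omega>)) \<longlonglongrightarrow> G 0 / 2 + G 1 / 2"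
    if Gc: "continuous_on UNIV G" and Gb: "\<And>t. 0 \<le> G t" "\<And>t. G t \<le> 1" for G :: "real \<Rightarrow> real"
  proof -
    have [measurable]: "G \<in> borel_measurable borel" using Gc by (rule borel_measurable_continuous_onI)
    have "(\<lambda>n. integral\<^sup>L (cnu (m n)) G) \<longlonglongrightarrow> integral\<^sup>L M G"
    proof (rule weak_conv_imp_integral_bdd_continuous_conv[OF real_distribution_cnu M wcm])
      show "isCont G x" for x using Gc by (simp add: continuous_on_eq_continuous_at)
      show "norm (G x) \<le> 1" for x using Gb by simp
    qed
    moreover have "integral\<^sup>L M G = G 0 / 2 + G 1 / 2"
      using M.two_point_if_ft_zero[OF supp _ _ zero, of G] u by simp
    ultimately show ?thesis by (simp add: integral_cnu)
  qed
  show False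
  \<comment> \<open>Either one bound on \<open>N (m n)\<close> holds infinitely often, or
    \<open>N (m n)\<close> tends to infinity.\<close>
  proof (cases "\<exists>K. \<exists>\<^sub>F n in sequentially. N (m n) \<le> K")
    case True
    then obtain K where K: "\<exists>\<^sub>F n in sequentially. N (m n) \<le> K" by blast
    have one: "ft M (real_of_int l) = 1" for l
    proof -
      have "ft M (real_of_int l) = (1/2) *\<^sub>R 1 + (1/2) *\<^sub>R cis (2 * pi * real_of_int l)"
        unfolding ft_def using M.two_point_if_ft_zero[OF supp _ _ zero, of "\<lambda>x. cis (2 * pi * real_of_int l * x)"] u by simp
      then show ?thesis by (simp add: cis_multiple_2pi scaleR_conv_of_real)
    qed
    have "(\<lambda>n. ft (nu (m n)) t - ft (cnu (m n)) t) \<longlonglongrightarrow> 0" for t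
    proof (rule Lim_null_comparison)
      show "(\<lambda>n. 2 * Om.prob (- good (m n))) \<longlonglongrightarrow> 0" using tendsto_mult_right_zero[OF bad] by simp
    qed (simp add: norm_ft_nu_minus_cnu)
    then have "(\<lambda>n. (ft (nu (m n)) (real_of_int l) - ft (cnu (m n)) (real_of_int l)) + ft (cnu (m n)) (real_of_int l)) \<longlonglongrightarrow> 0 + ft M (real_of_int l)" for l
      by (intro tendsto_add ftM)
    then have "(\<lambda>n. ft (nu (m n)) (real_of_int l)) \<longlonglongrightarrow> 1" for l by (simp add: one)
    then have "\<forall>\<^sub>F n in sequentially. ft (nu (m n)) (real_of_int l) \<noteq> 0" for l
      by (rule tendsto_imp_eventually_ne) simp
    \<comment> \<open>Finitely many integers are at stake, so nonvanishing eventually holds at all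
      of them together.\<close>
    then have "\<forall>\<^sub>F n in sequentially. \<forall>l\<in>{0<..K}. ft (nu (m n)) (real_of_int l) \<noteq> 0"
      by (intro eventually_ball_finite) auto
    then have "\<forall>\<^sub>F n in sequentially. \<not> N (m n) \<le> K"
    proof eventually_elim
      case (elim n)
      obtain l where "0 < l" "l < N (m n)" "ft (nu (m n)) (real_of_int l) = 0"
        using ft_nu_zero_int by blast
      then show ?case using elim by auto
    qed
    then show False using K by (simp add: frequently_def)
  next
    case False
    have Nbig: "\<forall>\<^sub>F n in sequentially. 1 / real_of_int (N (m n)) \<le> e" if "e > 0" for e :: real
    proof -
      have "\<forall>\<^sub>F n in sequentially. \<not> N (m n) \<le> \<lceil>1 / e\<rceil>"
        using False by (simp add: not_frequently)
      then show ?thesis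
      proof eventually_elim
        case (elim n)
        then have "1 / e < real_of_int (N (m n))" by linarith
        then show ?case using that N_pos[of "m n"] by (simp add: field_simps)
      qed
    qed
    have sbad: "- good (m n) \<in> sets Omega" for n
      using sets.compl_sets[OF good_sets[of "m n"]] by (simp add: Compl_eq_Diff_UNIV)
    from pcc obtain l :: real where l: "0 < l" "l < 1"
      and alt: "(\<exists>d1 d2 :: nat \<Rightarrow> real.
         (\<forall>k. 0 \<le> d1 k \<and> d1 k \<le> real_of_int (N (s k)) - 1 \<and>
              0 \<le> d2 k \<and> d2 k \<le> real_of_int (N (s k)) - 1 \<and>
              0 < (d2 k - d1 k) / real_of_int (N (s k)) \<and> (d2 k - d1 k) / real_of_int (N (s k)) < l) \<and>
         summable (\<lambda>k. real (card (B (s k) - {d \<in> B (s k). d1 k \<le> real_of_int d \<and> real_of_int d \<le> d2 k}))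
                        / real (card (B (s k)))))
      \<or>
      (\<exists>c::real. 0 < c \<and> c \<le> 1 \<and> (\<exists>d1 d2 :: nat \<Rightarrow> real.
         \<forall>k. l / 2 * real_of_int (N (s k)) \<le> d1 k \<and> d1 k \<le> (1 - l / 2) * real_of_int (N (s k)) \<and>
             l / 2 * real_of_int (N (s k)) \<le> d2 k \<and> d2 k \<le> (1 - l / 2) * real_of_int (N (s k)) \<and>
             real (card {d \<in> B (s k). d1 k \<le> real_of_int d \<and> real_of_int d \<le> d2 k})
               / real (card (B (s k))) \<ge> c))"
      unfolding pcc_def by blast
    \<comment> \<open>The tail after the leading digit lies in [0,1] and is divided by
      \<open>N (m n)\<close>, hence the additional \<open>1 / N (m n)\<close> on the right.\<close>
    have loc: "d1 / real_of_int (N (m n)) \<le> clamped (m n) \<omega> \<and>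
        clamped (m n) \<omega> \<le> d2 / real_of_int (N (m n)) + 1 / real_of_int (N (m n))"
      if g: "\<omega> \<in> good (m n)" and d: "d1 \<le> real_of_int (\<omega> (m n))" "real_of_int (\<omega> (m n)) \<le> d2" for n \<omega> d1 d2
    proof -
      have gS: "\<omega> \<in> good (Suc (m n))" using g good_mono[of "m n" "Suc (m n)"] by auto
      have "clamped (m n) \<omega> = (real_of_int (\<omega> (m n)) + tail (Suc (m n)) \<omega>) / real_of_int (N (m n))"
        unfolding clamped_good[OF g] by (rule tail_Suc[OF g])
      then show ?thesis
        using tail_bounds[OF gS] d N_pos[of "m n"] by (simp add: divide_right_mono flip: add_divide_distrib)
    qed
    from alt show False
    proof (elim disjE exE conjE)
      fix d1 d2 :: "nat \<Rightarrow> real"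
      assume d: "\<forall>k. 0 \<le> d1 k \<and> d1 k \<le> real_of_int (N (s k)) - 1 \<and>
              0 \<le> d2 k \<and> d2 k \<le> real_of_int (N (s k)) - 1 \<and>
              0 < (d2 k - d1 k) / real_of_int (N (s k)) \<and> (d2 k - d1 k) / real_of_int (N (s k)) < l"
        and sm: "summable (\<lambda>k. real (card (B (s k) - {d \<in> B (s k). d1 k \<le> real_of_int d \<and> real_of_int d \<le> d2 k}))
                        / real (card (B (s k))))"
      \<comment> \<open>With probability tending to 1 the digit avoids \<open>out\<close>, and then
        the clamped tail lies in an interval of length below \<open>l + 1 / N (m n)\<close>, too
        short to be close to both ends.\<close>
      define out where "out k = - {d. d1 k \<le> real_of_int d \<and> real_of_int d \<le> d2 k}" for k
      have "B (s k) \<inter> out k = B (s k) - {d \<in> B (s k). d1 k \<le> real_of_int d \<and> real_of_int d \<le> d2 k}" for k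
        by (auto simp: out_def)
      then have "(\<lambda>k. Om.prob {\<omega>. \<omega> (s k) \<in> out k}) \<longlonglongrightarrow> 0"
        unfolding prob_digit using summable_LIMSEQ_zero[OF sm] by simp
      then have outlim: "(\<lambda>n. Om.prob {\<omega>. \<omega> (m n) \<in> out (k n)}) \<longlonglongrightarrow> 0"
        unfolding m_def using k_top by (rule filterlim_compose)
      \<comment> \<open>The slack \<open>1 - l = 4 * a\<close> is split into a margin
        \<open>a\<close> at each end and \<open>2 * a\<close> for \<open>1 / N (m n)\<close>: a
        window starting before \<open>a\<close> ends before \<open>1 - a\<close>.\<close>
      define a where "a = (1 - l) / 4"
      have a: "0 < a" "a < 1" using l by (auto simp: a_def)
      have arith: "y + z \<le> 1 - a" if "y - x < l" "\<not> a \<le> x" "z \<le> 2 * a" for x y z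
        using that unfolding a_def by argo
      define G where "G t = max 0 (min 1 (1 - t / a))" for t
      have Gc: "continuous_on UNIV G" unfolding G_def using a by (intro continuous_intros) auto
      have Gb: "0 \<le> G t" "G t \<le> 1" for t by (auto simp: G_def)
      \<comment> \<open>By \<open>lim\<close> the integrals of \<open>G t\<close> and
        \<open>G (1 - t)\<close> both tend to 1/2; the threshold 1/4 below separates them from a
        vanishing probability.\<close>
      have G01: "G 0 = 1" "G 1 = 0" using a by (auto simp: G_def field_simps)
      have Gz: "G t = 0" if "t \<ge> a" for t using that a by (auto simp: G_def field_simps)
      have Gc': "continuous_on UNIV (\<lambda>t. G (1 - t))"
        by (rule continuous_on_compose2[OF Gc]) (auto intro!: continuous_intros)
      have Gm [measurable]: "G \<in> borel_measurable borel" using Gc by (rule borel_measurable_continuous_onI)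
      have "\<forall>\<^sub>F n in sequentially. (LINT \<omega>|Omega. G (clamped (m n) \<omega>)) > 1/4"
        using lim[OF Gc Gb] by (rule order_tendstoD) (simp add: G01)
      moreover have "\<forall>\<^sub>F n in sequentially. (LINT \<omega>|Omega. G (1 - clamped (m n) \<omega>)) > 1/4"
        using lim[OF Gc' Gb] by (rule order_tendstoD) (simp add: G01)
      moreover have "\<forall>\<^sub>F n in sequentially. 1 / real_of_int (N (m n)) \<le> 2 * a"
        using Nbig a by simp
      moreover have "\<forall>\<^sub>F n in sequentially. Om.prob (- good (m n)) + Om.prob {\<omega>. \<omega> (m n) \<in> out (k n)} < 1/4"
        using tendsto_add[OF bad outlim] by (rule order_tendstoD) simp
      ultimately have "\<forall>\<^sub>F n in sequentially. False"
      proof eventually_elim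
        case (elim n)
        let ?E = "- good (m n) \<union> {\<omega>. \<omega> (m n) \<in> out (k n)}"
        have Es: "?E \<in> sets Omega" using sbad sets_digit by (rule sets.Un)
        have "Om.prob ?E \<le> Om.prob (- good (m n)) + Om.prob {\<omega>. \<omega> (m n) \<in> out (k n)}"
          by (rule measure_Un_le[OF sbad sets_digit])
        then have PE: "Om.prob ?E < 1/4" using elim by linarith
        have loc': "d1 (k n) / real_of_int (N (m n)) \<le> clamped (m n) \<omega> \<and>
            clamped (m n) \<omega> \<le> d2 (k n) / real_of_int (N (m n)) + 1 / real_of_int (N (m n))" if "\<omega> \<notin> ?E" for \<omega>
          using that by (intro loc) (auto simp: out_def)
        show False
        proof (cases "d1 (k n) / real_of_int (N (m n)) \<ge> a")
          case True
          have "(LINT \<omega>|Omega. G (clamped (m n) \<omega>)) \<le> Om.prob ?E"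
          proof (rule integral_clamped_le_prob[OF Gm Es Gb])
            fix \<omega> assume "\<omega> \<notin> ?E"
            then show "G (clamped (m n) \<omega>) = 0" using loc' True by (intro Gz) (meson order_trans)
          qed
          then show False using elim PE by linarith
        next
          case False
          have "d2 (k n) / real_of_int (N (m n)) - d1 (k n) / real_of_int (N (m n)) < l"
            using d by (simp add: m_def diff_divide_distrib)
          then have ub: "d2 (k n) / real_of_int (N (m n)) + 1 / real_of_int (N (m n)) \<le> 1 - a"
            using False elim(3) by (rule arith)
          have "(LINT \<omega>|Omega. G (1 - clamped (m n) \<omega>)) \<le> Om.prob ?E"
          proof (rule integral_clamped_le_prob[where G = "\<lambda>t. G (1 - t)"])
            fix \<omega> assume "\<omega> \<notin> ?E"
            then have "clamped (m n) \<omega> \<le> 1 - a" using loc' ub by (meson order_trans)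
            then show "G (1 - clamped (m n) \<omega>) = 0" by (intro Gz) simp
          qed (use Es Gb in auto)
          then show False using elim PE by linarith
        qed
      qed
      then show False by simp
    next
      fix c :: real and d1 d2 :: "nat \<Rightarrow> real"
      assume c: "0 < c" "c \<le> 1"
        and d: "\<forall>k. l / 2 * real_of_int (N (s k)) \<le> d1 k \<and> d1 k \<le> (1 - l / 2) * real_of_int (N (s k)) \<and>
             l / 2 * real_of_int (N (s k)) \<le> d2 k \<and> d2 k \<le> (1 - l / 2) * real_of_int (N (s k)) \<and>
             real (card {d \<in> B (s k). d1 k \<le> real_of_int d \<and> real_of_int d \<le> d2 k})
               / real (card (B (s k))) \<ge> c"
      \<comment> \<open>A trapezoid vanishing at both ends, so its integrals tend to 0. It is 1 up
        to \<open>1 - l / 4\<close> because the window ends by \<open>1 - l / 2\<close> and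
        \<open>1 / N (m n)\<close> adds at most \<open>l / 4\<close>; there mass at least
        \<open>c / 2\<close> persists.\<close>
      define G where "G t = max 0 (min 1 (min (t / (l / 2)) ((1 - t) / (l / 4))))" for t
      have Gc: "continuous_on UNIV G" unfolding G_def using l by (intro continuous_intros) auto
      have Gb: "0 \<le> G t" "G t \<le> 1" for t by (auto simp: G_def)
      have G01: "G 0 = 0" "G 1 = 0" by (auto simp: G_def)
      have G1: "G t = 1" if "l / 2 \<le> t" "t \<le> 1 - l / 4" for t
      proof -
        have "t / (l / 2) \<ge> 1" "(1 - t) / (l / 4) \<ge> 1" using that l by (auto simp: field_simps)
        then show ?thesis by (simp add: G_def)
      qed
      have Gm [measurable]: "G \<in> borel_measurable borel" using Gc by (rule borel_measurable_continuous_onI)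
      have "\<forall>\<^sub>F n in sequentially. (LINT \<omega>|Omega. G (clamped (m n) \<omega>)) < c / 2"
        using lim[OF Gc Gb] by (rule order_tendstoD) (use c in \<open>simp add: G01\<close>)
      moreover have "\<forall>\<^sub>F n in sequentially. 1 / real_of_int (N (m n)) \<le> l / 4"
        using l by (intro Nbig) simp
      moreover have "\<forall>\<^sub>F n in sequentially. Om.prob (- good (m n)) < c / 2"
        using bad by (rule order_tendstoD) (use c in simp)
      ultimately have "\<forall>\<^sub>F n in sequentially. False"
      proof eventually_elim
        case (elim n)
        let ?A = "{d. d1 (k n) \<le> real_of_int d \<and> real_of_int d \<le> d2 (k n)}"
        let ?D = "{\<omega>. \<omega> (m n) \<in> ?A}"
        let ?E = "?D - (- good (m n))"
        have Ds: "?D \<in> sets Omega" by (rule sets_digit)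
        have Es: "?E \<in> sets Omega" by (rule sets.Diff[OF Ds sbad])
        have "B (m n) \<inter> ?A = {d \<in> B (m n). d1 (k n) \<le> real_of_int d \<and> real_of_int d \<le> d2 (k n)}" by auto
        then have "Om.prob ?D \<ge> c" unfolding prob_digit using d by (simp add: m_def)
        moreover have "Om.prob ?D \<le> Om.prob ?E + Om.prob (- good (m n))"
        proof -
          have "Om.prob ?D \<le> Om.prob (?E \<union> - good (m n))"
            by (rule Om.finite_measure_mono[OF _ sets.Un[OF Es sbad]]) auto
          also have "\<dots> \<le> Om.prob ?E + Om.prob (- good (m n))"
            by (rule measure_Un_le[OF Es sbad])
          finally show ?thesis .
        qed
        moreover have "Om.prob ?E \<le> (LINT \<omega>|Omega. G (clamped (m n) \<omega>))"
        proof (rule prob_le_integral_clamped[OF Gm Es Gb])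
          fix \<omega> assume "\<omega> \<in> ?E"
          then have w: "d1 (k n) / real_of_int (N (m n)) \<le> clamped (m n) \<omega> \<and>
            clamped (m n) \<omega> \<le> d2 (k n) / real_of_int (N (m n)) + 1 / real_of_int (N (m n))"
            by (intro loc) auto
          have "l / 2 \<le> d1 (k n) / real_of_int (N (m n))" "d2 (k n) / real_of_int (N (m n)) \<le> 1 - l / 2"
            using d N_pos[of "m n"] by (auto simp: m_def pos_le_divide_eq pos_divide_le_eq)
          then show "G (clamped (m n) \<omega>) = 1" using w elim(2) by (intro G1) linarith+
        qed
        ultimately show False using elim by linarith
      qed
      then show False by simp
    qed
  qed
qed

end

section \<open>Construction of the spectrum\<close>

context admissible_sequence
begin

text \<open>Near 0 the shift \<open>j = 0\<close> works. The radius there is \<open>2 * d\<close>: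
  one \<open>d\<close> for an old frequency divided by \<open>P m\<close>, the other for the
  displacement \<open>y\<close>.\<close>

lemma equi_positive_nu:
  fixes s :: "nat \<Rightarrow> nat"
  assumes s: "strict_mono s" and pcc: "pcc (\<lambda>k. N (s k)) (\<lambda>k. B (s k))"
  obtains e d K where "e > 0" "d > 0"
    "\<And>k x. k \<ge> K \<Longrightarrow> \<exists>j::int. \<forall>y. \<bar>y\<bar> \<le> d \<longrightarrow> cmod (ft (nu (s k)) (x + real_of_int j + y)) \<ge> e"
    "\<And>k y. k \<ge> K \<Longrightarrow> \<bar>y\<bar> \<le> 2 * d \<Longrightarrow> cmod (ft (nu (s k)) y) \<ge> e"
proof -
  obtain e0 K0 where e0: "e0 > 0"
    and pos: "\<And>k x. k \<ge> K0 \<Longrightarrow> \<exists>j::int. cmod (ft (cnu (s k)) (x + real_of_int j)) \<ge> e0"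
    using equi_positive[OF s pcc] by blast
  have "e0 \<le> 1"
    using pos[of K0 0] real_distribution.norm_ft_le_1[OF real_distribution_cnu] by (meson order_refl order_trans)
  have "filterlim s at_top sequentially" using s by (rule filterlim_subseq)
  with prob_bad_tendsto_0 have "(\<lambda>k. Om.prob (- good (s k))) \<longlonglongrightarrow> 0" by (rule filterlim_compose)
  then have "\<forall>\<^sub>F k in sequentially. Om.prob (- good (s k)) < e0 / 8"
    using e0 by (intro order_tendstoD) auto
  then obtain K1 where K1: "\<And>k. k \<ge> K1 \<Longrightarrow> Om.prob (- good (s k)) < e0 / 8"
    by (auto simp: eventually_sequentially)
  have near: "cmod (ft (nu (s k)) t) \<ge> cmod (ft (cnu (s k)) t') - 2 * pi * \<bar>t' - t\<bar> - e0 / 4" if "k \<ge> K1" for k t t'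
  proof -
    have "cmod (ft (nu (s k)) t - ft (cnu (s k)) t) \<le> e0 / 4"
      using norm_ft_nu_minus_cnu[of "s k" t] K1[OF that] by linarith
    moreover note ft_cnu_lipschitz[of "s k" t' t]
    moreover have "cmod (ft (cnu (s k)) t') \<le> cmod (ft (cnu (s k)) t' - ft (cnu (s k)) t) + cmod (ft (cnu (s k)) t)"
      using norm_triangle_ineq[of "ft (cnu (s k)) t' - ft (cnu (s k)) t" "ft (cnu (s k)) t"] by simp
    moreover have "cmod (ft (cnu (s k)) t) \<le> cmod (ft (nu (s k)) t) + cmod (ft (nu (s k)) t - ft (cnu (s k)) t)"
      using norm_triangle_ineq4[of "ft (nu (s k)) t" "ft (nu (s k)) t - ft (cnu (s k)) t"] by simp
    ultimately show ?thesis by linarith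
  qed
  \<comment> \<open>Moving by \<open>d\<close> costs \<open>e0 / 4\<close>, and passing from
    \<open>cnu\<close> to \<open>nu\<close> costs another \<open>e0 / 4\<close>. Starting from
    \<open>e0\<close> this leaves \<open>e0 / 2\<close>; starting from 1 at the origin with radius
    \<open>2 * d\<close> it leaves \<open>1 - 3 * e0 / 4\<close>, which is at least
    \<open>e0 / 4\<close> as \<open>e0 \<le> 1\<close>.\<close>
  define d where "d = e0 / (8 * pi)"
  have d: "d > 0" and pd: "2 * pi * d = e0 / 4" using e0 by (auto simp: d_def)
  show ?thesis
  proof (rule that[of "e0 / 4" d "max K0 K1"])
    fix k x assume k: "k \<ge> max K0 K1"
    obtain j :: int where j: "cmod (ft (cnu (s k)) (x + real_of_int j)) \<ge> e0" using pos[of k x] k by auto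
    have "cmod (ft (nu (s k)) (x + real_of_int j + y)) \<ge> e0 / 4" if y: "\<bar>y\<bar> \<le> d" for y
    proof -
      have "2 * pi * \<bar>x + real_of_int j - (x + real_of_int j + y)\<bar> \<le> 2 * pi * d"
        using y by (intro mult_left_mono) auto
      then show ?thesis using near[of k "x + real_of_int j" "x + real_of_int j + y"] k j pd e0 by linarith
    qed
    then show "\<exists>j::int. \<forall>y. \<bar>y\<bar> \<le> d \<longrightarrow> cmod (ft (nu (s k)) (x + real_of_int j + y)) \<ge> e0 / 4" by blast
  next
    fix k y assume k: "k \<ge> max K0 K1" and y: "\<bar>y\<bar> \<le> 2 * d"
    have "2 * pi * \<bar>0 - y\<bar> \<le> 2 * pi * (2 * d)" using y by (intro mult_left_mono) auto
    moreover have "ft (cnu (s k)) 0 = 1" by (rule real_distribution.ft_zero[OF real_distribution_cnu])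
    ultimately have "1 - 2 * pi * \<bar>0 - y\<bar> - e0 / 4 \<le> cmod (ft (nu (s k)) y)"
      using near[of k 0 y] k by simp
    moreover have "2 * pi * (2 * d) = e0 / 2" using pd by simp
    ultimately show "cmod (ft (nu (s k)) y) \<ge> e0 / 4"
      using \<open>2 * pi * \<bar>0 - y\<bar> \<le> 2 * pi * (2 * d)\<close> \<open>e0 \<le> 1\<close> by linarith
  qed (use e0 d in auto)
qed

text \<open>Shifting a frequency by a multiple of \<open>P m'\<close> does not change the finite Parseval identity,
  and equi-positivity says which shift keeps the transform of the remaining tail away from zero.\<close>

lemma partial_spectrum_step:
  fixes s :: "nat \<Rightarrow> nat"
  assumes s: "strict_mono s" and d: "d > 0"
    and pos: "\<And>k x. k \<ge> K \<Longrightarrow> \<exists>j::int. \<forall>y. \<bar>y\<bar> \<le> d \<longrightarrow> cmod (ft (nu (s k)) (x + real_of_int j + y)) \<ge> e"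
    and pos0: "\<And>k y. k \<ge> K \<Longrightarrow> \<bar>y\<bar> \<le> 2 * d \<Longrightarrow> cmod (ft (nu (s k)) y) \<ge> e"
    and S: "partial_spectrum m S"
  shows "\<exists>m' S'. m < m' \<and> S \<subseteq> S' \<and> partial_spectrum m' S' \<and>
    (\<forall>t\<in>S'. \<forall>y. \<bar>y\<bar> \<le> d \<longrightarrow> cmod (ft (nu m') (real_of_int t / real_of_int (P m') + y)) \<ge> e)"
proof -
  have "finite S" using S by (simp add: partial_spectrum_def)
  then obtain C where C: "\<And>t. t \<in> S \<Longrightarrow> \<bar>real_of_int t\<bar> \<le> C"
    using finite_imp_bounded[of "real_of_int ` S"] by (auto simp: bounded_iff)
  obtain n0 where n0: "C / d < 2 ^ n0" using real_arch_pow[of 2 "C / d"] by auto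
  \<comment> \<open>\<open>Suc m\<close> forces \<open>m < m'\<close>, and \<open>n0\<close> brings
    all of \<open>S\<close>, divided by \<open>P m'\<close>, within \<open>d\<close> of 0.\<close>
  define k where "k = max K (max (Suc m) n0)"
  define m' where "m' = s k"
  have k: "k \<ge> K" "k > m" "k \<ge> n0" by (auto simp: k_def)
  have "m' \<ge> k" using seq_suble[OF s, of k] by (simp add: m'_def)
  then have mm: "m < m'" "n0 \<le> m'" using k by auto
  have "C / d \<le> real_of_int (P m')"
  proof -
    have "C / d \<le> 2 ^ n0" using n0 by simp
    also have "\<dots> \<le> 2 ^ m'" using mm by simp
    also have "\<dots> \<le> real_of_int (P m')" using P_ge_power[of m'] by (metis of_int_le_iff of_int_numeral of_int_power)
    finally show ?thesis .
  qed
  then have Cd: "C / real_of_int (P m') \<le> d" using d P_pos[of m'] by (simp add: field_simps)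
  obtain S0 where S0: "S \<subseteq> S0" "partial_spectrum m' S0"
    using partial_spectrum_extend[OF S, of m'] mm by auto
  have "\<forall>t. \<exists>j::int. \<forall>y. \<bar>y\<bar> \<le> d \<longrightarrow> cmod (ft (nu m') (real_of_int t / real_of_int (P m') + real_of_int j + y)) \<ge> e" 
    unfolding m'_def using pos[OF k(1)] by blast
  then obtain J :: "int \<Rightarrow> int" where J: "\<And>t y. \<bar>y\<bar> \<le> d \<Longrightarrow> cmod (ft (nu m') (real_of_int t / real_of_int (P m') + real_of_int (J t) + y)) \<ge> e"
    by metis
  \<comment> \<open>Old frequencies stay fixed, which keeps the spectra nested; being close to 0
    after division they are covered by \<open>pos0\<close>.\<close>
  define j where "j t = (if t \<in> S then 0 else J t)" for t
  define S' where "S' = (\<lambda>t. t + P m' * j t) ` S0"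
  have "cmod (ft (nu m') (real_of_int (t + P m' * j t) / real_of_int (P m') + y)) \<ge> e" if y: "\<bar>y\<bar> \<le> d" for t y
  proof (cases "t \<in> S")
    case True
    have "\<bar>real_of_int t / real_of_int (P m')\<bar> \<le> C / real_of_int (P m')"
      using C[OF True] P_pos[of m'] by (simp add: abs_divide divide_right_mono)
    then have "\<bar>real_of_int t / real_of_int (P m') + y\<bar> \<le> 2 * d" using Cd y by linarith
    then show ?thesis using True pos0[OF k(1)] by (simp add: j_def m'_def)
  next
    case False
    have "real_of_int (t + P m' * j t) / real_of_int (P m') + y = real_of_int t / real_of_int (P m') + real_of_int (J t) + y"
      using False P_pos[of m'] by (simp add: j_def field_simps)
    then show ?thesis using J[OF y, of t] by (simp only:)
  qed
  then have "\<forall>t\<in>S'. \<forall>y. \<bar>y\<bar> \<le> d \<longrightarrow> cmod (ft (nu m') (real_of_int t / real_of_int (P m') + y)) \<ge> e"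
    by (auto simp: S'_def)
  moreover have "S \<subseteq> S'" using S0(1) by (force simp: S'_def j_def)
  moreover have "partial_spectrum m' S'" unfolding S'_def by (rule partial_spectrum_shift[OF S0(2)])
  ultimately show ?thesis using mm by blast
qed

theorem spectral_measure_nu_0:
  fixes s :: "nat \<Rightarrow> nat"
  assumes s: "strict_mono s" and pcc: "pcc (\<lambda>k. N (s k)) (\<lambda>k. B (s k))"
  shows "spectral_measure (nu 0)"
proof -
  obtain e d K where e: "e > 0" and d: "d > 0"
    and pos: "\<And>k x. k \<ge> K \<Longrightarrow> \<exists>j::int. \<forall>y. \<bar>y\<bar> \<le> d \<longrightarrow> cmod (ft (nu (s k)) (x + real_of_int j + y)) \<ge> e"
    and pos0: "\<And>k y. k \<ge> K \<Longrightarrow> \<bar>y\<bar> \<le> 2 * d \<Longrightarrow> cmod (ft (nu (s k)) y) \<ge> e"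
    using equi_positive_nu[OF s pcc] by metis
  have step: "\<exists>m' S'. m < m' \<and> S \<subseteq> S' \<and> partial_spectrum m' S' \<and>
      (\<forall>t\<in>S'. \<forall>y. \<bar>y\<bar> \<le> d \<longrightarrow> cmod (ft (nu m') (real_of_int t / real_of_int (P m') + y)) \<ge> e)"
    if "partial_spectrum m S" for m S
    by (rule partial_spectrum_step[where s = s and K = K]) (fact s d pos pos0 that)+
  define good_pair where "good_pair p \<longleftrightarrow> partial_spectrum (fst p) (snd p) \<and>
    (\<forall>t\<in>snd p. \<forall>y. \<bar>y\<bar> \<le> d \<longrightarrow> cmod (ft (nu (fst p)) (real_of_int t / real_of_int (P (fst p)) + y)) \<ge> e)" for p
  have init: "\<exists>p. good_pair p"
  proof -
    have "partial_spectrum 0 {0}" by (simp add: partial_spectrum_def)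
    from step[OF this] show ?thesis by (auto simp: good_pair_def)
  qed
  have "\<exists>f. \<forall>n::nat. good_pair (f n) \<and> (fst (f n) < fst (f (Suc n)) \<and> snd (f n) \<subseteq> snd (f (Suc n)))"
  proof (rule dependent_nat_choice[OF init])
    fix p :: "nat \<times> int set" and n :: nat assume "good_pair p"
    then have "partial_spectrum (fst p) (snd p)" by (simp add: good_pair_def)
    from step[OF this] show "\<exists>q. good_pair q \<and> (fst p < fst q \<and> snd p \<subseteq> snd q)"
      by (auto simp: good_pair_def)
  qed
  then obtain f where f: "\<And>n. good_pair (f n)" "\<And>n. fst (f n) < fst (f (Suc n))" "\<And>n. snd (f n) \<subseteq> snd (f (Suc n))"
    by blast
  define m where "m n = fst (f n)" for n
  define S where "S n = snd (f n)" for n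
  have spec: "partial_spectrum (m n) (S n)" for n using f(1)[of n] by (simp add: good_pair_def m_def S_def)
  then have finS: "finite (S n)" for n by (simp add: partial_spectrum_def)
  have low: "cmod (ft (nu (m n)) (real_of_int t / real_of_int (P (m n)) + y)) \<ge> e" if "t \<in> S n" "\<bar>y\<bar> \<le> d" for n t y
    using f(1)[of n] that by (simp add: good_pair_def m_def S_def)
  have m_mono: "strict_mono m" using f(2) by (simp add: strict_mono_Suc_iff m_def)
  have S_mono: "i \<le> n \<Longrightarrow> S i \<subseteq> S n" for i n
    by (rule lift_Suc_mono_le[of S]) (use f(3) in \<open>auto simp: S_def\<close>)
  have le: "cmod (ft (nu 0) t) \<le> cmod (pft n t)" for t n
    unfolding ft_nu_0[of t n] norm_mult
    by (intro mult_left_le real_distribution.norm_ft_le_1[OF real_distribution_nu]) simp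
  interpret M: real_distribution "nu 0" by (rule real_distribution_nu)
  show ?thesis
  proof (rule M.spectral_measureI[where Lam = "real_of_int ` (\<Union>n. S n)"])
    show "countable (real_of_int ` (\<Union>n. S n))" by simp
  next
    fix u v assume "u \<in> real_of_int ` (\<Union>n. S n)" "v \<in> real_of_int ` (\<Union>n. S n)" and ne: "u \<noteq> v"
    then obtain a b i j where ab: "a \<in> S i" "b \<in> S j" "u = real_of_int a" "v = real_of_int b" by auto
    then have ab': "a \<in> S (max i j)" "b \<in> S (max i j)" "a \<noteq> b"
      using S_mono[of i "max i j"] S_mono[of j "max i j"] ne by auto
    have "pft (m (max i j)) (u - v) = 0"
      using partial_spectrum_orthogonal[OF spec ab'] ab by simp
    then show "ft (nu 0) (u - v) = 0" by (simp add: ft_nu_0[of _ "m (max i j)"])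
  next
    fix w eta :: real assume eta: "eta > 0"
    define F where "F t = (cmod (ft (nu 0) (- w + real_of_int t)))\<^sup>2" for t
    define Fp where "Fp n t = (cmod (pft (m n) (- w + real_of_int t)))\<^sup>2" for n t
    have Fp1: "(\<Sum>t\<in>S n. Fp n t) = 1" for n using spec[of n] unfolding partial_spectrum_def Fp_def by blast
    have F_le: "F t \<le> Fp n t" for n t unfolding F_def Fp_def by (intro power_mono le) simp
    have F_nn: "F t \<ge> 0" for t by (simp add: F_def)
    \<comment> \<open>Dominated convergence in elementary form: these partial sums increase and stay
      below 1, so all but a small part of their limit is already collected on some
      \<open>S i\<close>.\<close>
    define a where "a n = (\<Sum>t\<in>S n. F t)" for n
    have "incseq a" unfolding incseq_def a_def using S_mono finS F_nn by (auto intro!: sum_mono2)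
    moreover have "a n \<le> 1" for n
      unfolding a_def Fp1[of n, symmetric] by (intro sum_mono F_le)
    ultimately obtain L where L: "a \<longlonglongrightarrow> L" "\<And>n. a n \<le> L" using incseq_convergent[of a 1] by auto
    have e2: "e\<^sup>2 * eta / 2 > 0" using e eta by simp
    then have "\<forall>\<^sub>F n in sequentially. a n > L - e\<^sup>2 * eta / 2" using L(1) by (intro order_tendstoD) auto
    \<comment> \<open>The factor \<open>e\<^sup>2\<close> compensates the division by
      \<open>e\<^sup>2\<close> in the domination \<open>up\<close>.\<close>
    then obtain i where i: "a i > L - e\<^sup>2 * eta / 2" by (auto simp: eventually_sequentially)
    obtain n0 where n0: "\<bar>w\<bar> / d < 2 ^ n0" using real_arch_pow[of 2 "\<bar>w\<bar> / d"] by auto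
    \<comment> \<open>The finite summands outside \<open>S i\<close> total at most
      \<open>eta / 2\<close> uniformly in \<open>n\<close>, so the limit is taken over a fixed
      finite set.\<close>
    have key: "1 \<le> (\<Sum>t\<in>S i. Fp n t) + eta / 2" if n: "n \<ge> max i n0" for n
    proof -
      have "\<bar>w\<bar> / d \<le> real_of_int (P (m n))"
      proof -
        have "n0 \<le> m n" using seq_suble[OF m_mono, of n] n by simp
        then have "(2::real) ^ n0 \<le> 2 ^ m n" by simp
        also have "\<dots> \<le> real_of_int (P (m n))" using P_ge_power[of "m n"] by (metis of_int_le_iff of_int_numeral of_int_power)
        finally show ?thesis using n0 by linarith
      qed
      \<comment> \<open>The shift by \<open>w\<close> becomes a displacement of at most
        \<open>d\<close>; for this reason \<open>low\<close> holds on an interval of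
        \<open>y\<close> and not just at 0.\<close>
      then have wd: "\<bar>- w / real_of_int (P (m n))\<bar> \<le> d" using d P_pos[of "m n"] by (simp add: abs_divide field_simps)
      have up: "Fp n t \<le> F t / e\<^sup>2" if "t \<in> S n" for t
      proof -
        have eq: "(- w + real_of_int t) / real_of_int (P (m n)) = real_of_int t / real_of_int (P (m n)) + - w / real_of_int (P (m n))"
          by (simp add: diff_divide_distrib)
        have "cmod (pft (m n) (- w + real_of_int t)) * e \<le> cmod (ft (nu 0) (- w + real_of_int t))"
          unfolding ft_nu_0[of "- w + real_of_int t" "m n"] norm_mult eq
          by (intro mult_left_mono low[OF that wd]) simp
        then have "(cmod (pft (m n) (- w + real_of_int t)) * e)\<^sup>2 \<le> F t"
          unfolding F_def using e by (intro power_mono) auto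
        then show ?thesis using e by (simp add: Fp_def power_mult_distrib field_simps)
      qed
      have sub: "S i \<subseteq> S n" using n by (intro S_mono) simp
      have "1 = (\<Sum>t\<in>S i. Fp n t) + (\<Sum>t\<in>S n - S i. Fp n t)"
        using Fp1[of n] sum.subset_diff[OF sub finS, of "Fp n"] by simp
      also have "(\<Sum>t\<in>S n - S i. Fp n t) \<le> (\<Sum>t\<in>S n - S i. F t / e\<^sup>2)"
        using up by (intro sum_mono) auto
      also have "\<dots> = (a n - a i) / e\<^sup>2"
        unfolding a_def using sum.subset_diff[OF sub finS, of F] by (simp add: sum_divide_distrib[symmetric])
      also have "\<dots> \<le> (e\<^sup>2 * eta / 2) / e\<^sup>2"
        using i L(2)[of n] by (intro divide_right_mono) auto
      also have "\<dots> = eta / 2" using e by simp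
      finally show ?thesis by simp
    qed
    have "(\<lambda>n. (\<Sum>t\<in>S i. Fp n t) + eta / 2) \<longlonglongrightarrow> (\<Sum>t\<in>S i. F t) + eta / 2"
      unfolding Fp_def F_def
      by (intro tendsto_intros LIMSEQ_subseq_LIMSEQ[OF pft_tendsto m_mono, unfolded o_def])
    then have "1 \<le> (\<Sum>t\<in>S i. F t) + eta / 2"
      by (rule LIMSEQ_le_const) (use key in blast)
    moreover have "(\<Sum>u\<in>real_of_int ` S i. (cmod (ft (nu 0) (u - w)))\<^sup>2) = (\<Sum>t\<in>S i. F t)"
      unfolding F_def by (subst sum.reindex) (auto simp: inj_on_def)
    ultimately show "\<exists>F. finite F \<and> F \<subseteq> real_of_int ` (\<Union>n. S n) \<and> (\<Sum>u\<in>F. (cmod (ft (nu 0) (u - w)))\<^sup>2) > 1 - eta"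
      using eta finS[of i] by (intro exI[of _ "real_of_int ` S i"]) auto
  qed
qed

end

theorem theorem2p5:
  fixes N :: "nat \<Rightarrow> int" and B :: "nat \<Rightarrow> int set"
  assumes adm: "\<And>n. admissible_pair (N n) (B n)"
    and pos: "\<And>n. N n > 0"
    and rbc: "summable (\<lambda>n. real (card (B n - {0..N n - 1})) / real (card (B n)))"
    and sub: "\<exists>s :: nat \<Rightarrow> nat. strict_mono s \<and> pcc (\<lambda>k. N (s k)) (\<lambda>k. B (s k))"
  shows "\<exists>\<mu>. sets \<mu> = sets borel \<and> prob_space \<mu> \<and>
           weak_limit (conv_partial N B) \<mu> \<and> spectral_measure \<mu>"
proof -
  interpret admissible_sequence N B using adm pos rbc by unfold_locales
  obtain s where s: "strict_mono s" "pcc (\<lambda>k. N (s k)) (\<lambda>k. B (s k))" using sub by blast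
  interpret M: real_distribution "nu 0" by (rule real_distribution_nu)
  show ?thesis
    using M.events_eq_borel M.prob_space_axioms weak_limit_conv_partial spectral_measure_nu_0[OF s] by blast
qed

end
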